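(* Let $\mathcal H,\mathcal K$ be separable complex Hilbert spaces and assume: (i) $H_0$ is a densely defined closed linear operator in $\mathcal H$ with $\rho(H_0)\neq\emptyset$; $A\colon\operatorname{dom}(A)\to\mathcal K$ and $B\colon\operatorname{dom}(B)\to\mathcal K$, with $\operatorname{dom}(A),\operatorname{dom}(B)\subseteq\mathcal H$, are densely defined closed linear operators such that $\operatorname{dom}(A)\supseteq\operatorname{dom}(H_0)$ and $\operatorname{dom}(B)\supseteq\operatorname{dom}(H_0^* )$; (ii) for some (and hence all) $z\in\rho(H_0)$ the operator $-AR_0(z)B^*$, defined on $\operatorname{dom}(B^* )$, has a bounded extension $K(z)=-\overline{AR_0(z)B^*}\in\mathcal B(\mathcal K)$; (iii) $1\in\rho(K(z_0))$ for some $z_0\in\rho(H_0)$; (iv) $K(z)$ is compact for all $z\in\rho(H_0)$. Let $H$ be the operator in $\mathcal H$ with resolvent $R(z)$ described in the context, and let $\lambda_0\in\rho(H_0)$. Then $$Hf=\lambda_0 f,\ 0\neq f\in\operatorname{dom}(H)\quad\text{implies}\quad K(\lambda_0)g=g,$$ where, for fixed $z_0\in\{\zeta\in\rho(H_0)\mid 1\in\rho(K(\zeta))\}$, $z_0\neq\lambda_0$, $$0\neq g=[I_{\mathcal K}-K(z_0)]^{-1}AR_0(z_0)f=(\lambda_0-z_0)^{-1}Af .$$ Conversely, $$K(\lambda_0)g=g,\ 0\neq g\in\mathcal K\quad\text{implies}\quad Hf=\lambda_0f,\quad\text{where } 0\neq f=-\overline{R_0(\lambda_0)B^*}\,g\in\operatorname{dom}(H).$$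 Moreover, $$\dim(\ker(H-\lambda_0I_{\mathcal H}))=\dim(\ker(I_{\mathcal K}-K(\lambda_0)))<\infty .$$ In particular, for $z\in\rho(H_0)$: $z\in\rho(H)$ if and only if $1\in\rho(K(z))$.
   Context: Notation: $\rho(T)$ is the resolvent set of a closed operator $T$, $\overline{S}$ the closure of a closable operator $S$, $\mathcal B(\cdot)$ the bounded operators, and $R_0(z)=(H_0-zI_{\mathcal H})^{-1}$ for $z\in\rho(H_0)$. One has $AR_0(z)\in\mathcal B(\mathcal H,\mathcal K)$ and $\overline{R_0(z)B^*}=[B(H_0^*-\overline z)^{-1}]^*\in\mathcal B(\mathcal K,\mathcal H)$. Definition of $H$: for $z\in\rho(H_0)$ with $1\in\rho(K(z))$ put $$R(z)=R_0(z)-\overline{R_0(z)B^*}\,[I_{\mathcal K}-K(z)]^{-1}AR_0(z).$$ Under (i)–(iii), there is a unique densely defined closed linear operator $H$ in $\mathcal H$, independent of $z$, such that $R(z)=(H-zI_{\mathcal H})^{-1}$ for all such $z$. $H$ extends $H_0+B^*A$ defined on $\operatorname{dom}(H_0)\cap\operatorname{dom}(B^*A)$. *)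

theory Defs
  imports "HOL-Analysis.Analysis"
begin

section \<open>Complex Hilbert spaces\<close>

class complex_vector = real_vector +
  fixes scaleC :: "complex \<Rightarrow> 'a \<Rightarrow> 'a"  (infixr \<open>*\<^sub>C\<close> 75)
  assumes scaleC_add_right: "a *\<^sub>C (x + y) = a *\<^sub>C x + a *\<^sub>C y"
    and scaleC_add_left: "(a + b) *\<^sub>C x = a *\<^sub>C x + b *\<^sub>C x"
    and scaleC_scaleC: "a *\<^sub>C (b *\<^sub>C x) = (a * b) *\<^sub>C x"
    and scaleC_one: "1 *\<^sub>C x = x"
    and scaleR_scaleC: "r *\<^sub>R x = complex_of_real r *\<^sub>C x"

global_interpretation complex_vector:
  vector_space "scaleC :: complex \<Rightarrow> 'a \<Rightarrow> 'a::complex_vector"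
  defines cspan = complex_vector.span
    and cdim = complex_vector.dim
  by unfold_locales
    (simp_all add: scaleC_add_right scaleC_add_left scaleC_scaleC scaleC_one)

text \<open>The inner product is linear in the second argument.\<close>

class complex_inner = complex_vector + real_normed_vector +
  fixes cinner :: "'a \<Rightarrow> 'a \<Rightarrow> complex"
  assumes cinner_commute: "cinner x y = cnj (cinner y x)"
    and cinner_add_right: "cinner x (y + z) = cinner x y + cinner x z"
    and cinner_scaleC_right: "cinner x (a *\<^sub>C y) = a * cinner x y"
    and cinner_ge_zero: "0 \<le> Re (cinner x x)"
    and norm_eq_sqrt_cinner: "norm x = sqrt (Re (cinner x x))"

class chilbert_space = complex_inner + complete_space

instantiation complex :: chilbert_space
begin

definition scaleC_complex :: "complex \<Rightarrow> complex \<Rightarrow> complex"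
  where "scaleC_complex a x = a * x"

definition cinner_complex :: "complex \<Rightarrow> complex \<Rightarrow> complex"
  where "cinner_complex x y = cnj x * y"

instance
proof
  fix x :: complex
  show "norm x = sqrt (Re (cinner x x))"
    by (simp add: cinner_complex_def cmod_def power2_eq_square)
qed (simp_all add: scaleC_complex_def cinner_complex_def algebra_simps scaleR_conv_of_real)

end

text \<open>\<^term>\<open>cdim\<close> is \<open>0\<close> on infinite-dimensional spaces, so finiteness is a separate predicate.\<close>

definition finite_cdim :: "'a::complex_vector set \<Rightarrow> bool"
  where "finite_cdim V \<longleftrightarrow> (\<exists>b. finite b \<and> V \<subseteq> cspan b)"


section \<open>Unbounded operators\<close>

text \<open>An operator with domain in \<open>'a\<close> and values in \<open>'b\<close> is identified with its graph. Then
  \<open>T f = g\<close> (including \<open>f \<in> dom T\<close>) reads \<^prop>\<open>(f, g) \<in> T\<close>, the domain is \<^term>\<open>Domain T\<close>,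
  \<open>S \<subseteq> T\<close> says that \<open>T\<close> extends \<open>S\<close>, the inverse is \<^term>\<open>T\<inverse>\<close>, the operator closure is the
  topological \<^const>\<open>closure\<close> of the graph in the product space, and \<^term>\<open>Id\<close> is the identity
  operator. The algebraic operations below have their natural (maximal) domains.\<close>

type_synonym ('a, 'b) operator = "('a \<times> 'b) set"

definition linear_operator :: "('a::complex_vector, 'b::complex_vector) operator \<Rightarrow> bool"
  where "linear_operator T \<longleftrightarrow> single_valued T \<and> (0, 0) \<in> T \<and>
    (\<forall>x y x' y'. (x, y) \<in> T \<longrightarrow> (x', y') \<in> T \<longrightarrow> (x + x', y + y') \<in> T) \<and>
    (\<forall>c x y. (x, y) \<in> T \<longrightarrow> (c *\<^sub>C x, c *\<^sub>C y) \<in> T)"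

definition densely_defined :: "('a::topological_space, 'b) operator \<Rightarrow> bool"
  where "densely_defined T \<longleftrightarrow> closure (Domain T) = UNIV"

definition closed_operator :: "('a::complex_inner, 'b::complex_inner) operator \<Rightarrow> bool"
  where "closed_operator T \<longleftrightarrow> linear_operator T \<and> closed T"

definition bounded_operators :: "('a::complex_inner, 'b::complex_inner) operator set"
  where "bounded_operators =
    {T. linear_operator T \<and> Domain T = UNIV \<and> (\<exists>M. \<forall>(x, y) \<in> T. norm y \<le> M * norm x)}"

definition compact_operator :: "('a::complex_inner, 'b::complex_inner) operator \<Rightarrow> bool"
  where "compact_operator T \<longleftrightarrow> T \<in> bounded_operators \<and> compact (closure (T `` cball 0 1))"

definition op_comp :: "('b, 'c) operator \<Rightarrow> ('a, 'b) operator \<Rightarrow> ('a, 'c) operator"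
    (infixr \<open>\<circ>\<^sub>o\<close> 75)
  where "S \<circ>\<^sub>o T = {(x, z). \<exists>y. (x, y) \<in> T \<and> (y, z) \<in> S}"

definition op_diff :: "('a, 'b::complex_vector) operator \<Rightarrow> ('a, 'b) operator \<Rightarrow> ('a, 'b) operator"
    (infixl \<open>-\<^sub>o\<close> 65)
  where "S -\<^sub>o T = {(x, y - y') | x y y'. (x, y) \<in> S \<and> (x, y') \<in> T}"

definition op_scale :: "complex \<Rightarrow> ('a, 'b::complex_vector) operator \<Rightarrow> ('a, 'b) operator"
    (infixr \<open>\<cdot>\<^sub>o\<close> 70)
  where "c \<cdot>\<^sub>o T = {(x, c *\<^sub>C y) | x y. (x, y) \<in> T}"

definition op_ker :: "('a, 'b::zero) operator \<Rightarrow> 'a set"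
  where "op_ker T = {x. (x, 0) \<in> T}"

text \<open>Single-valued, hence an operator, when \<open>T\<close> is densely defined.\<close>

definition op_adj :: "('a::complex_inner, 'b::complex_inner) operator \<Rightarrow> ('b, 'a) operator"
  where "op_adj T = {(y, z). \<forall>(x, w) \<in> T. cinner y w = cinner z x}"

definition resolvent :: "('a::complex_inner, 'a) operator \<Rightarrow> complex \<Rightarrow> ('a, 'a) operator"
  where "resolvent T z = (T -\<^sub>o z \<cdot>\<^sub>o Id)\<inverse>"

definition resolvent_set :: "('a::complex_inner, 'a) operator \<Rightarrow> complex set"
  where "resolvent_set T = {z. resolvent T z \<in> bounded_operators}"


section \<open>The factorized perturbation\<close>

definition birman_schwinger ::
    "('h::complex_inner, 'h) operator \<Rightarrow> ('h, 'k::complex_inner) operator \<Rightarrow> ('h, 'k) operator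
      \<Rightarrow> complex \<Rightarrow> ('k, 'k) operator"
  where "birman_schwinger H0 A B z = (- 1) \<cdot>\<^sub>o closure (A \<circ>\<^sub>o resolvent H0 z \<circ>\<^sub>o op_adj B)"

definition perturbed_resolvent ::
    "('h::complex_inner, 'h) operator \<Rightarrow> ('h, 'k::complex_inner) operator \<Rightarrow> ('h, 'k) operator
      \<Rightarrow> complex \<Rightarrow> ('h, 'h) operator"
  where "perturbed_resolvent H0 A B z =
    resolvent H0 z -\<^sub>o
      closure (resolvent H0 z \<circ>\<^sub>o op_adj B) \<circ>\<^sub>o (Id -\<^sub>o birman_schwinger H0 A B z)\<inverse>
        \<circ>\<^sub>o A \<circ>\<^sub>o resolvent H0 z"

end

(*
  Write R0 for the resolvent of H0, G for the closure of R0 B*, and J for the inverse of 1 - K at a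
  regular point z0, that is, one with 1 in the resolvent set of K(z0). Closedness of A gives
  A G = -K on the whole space, and the resolvent identity for R0 passes to
  G(z) - G(w) = (z - w) R0(z) G(w). Since H - z0 inverts to R0 - G J A R0, a short computation shows
  that -G(l0) maps ker(1 - K(l0)) bijectively onto ker(H - l0): it is injective as A(-G g) = K g.
  The equivalence of z in rho(H) with 1 in rho(K(z)) needs no Fredholm theory: for z in rho(H) the
  inverse of 1 - K(z) is written down explicitly. Boundedness of inverses is the closed graph theorem.
  Compactness enters only through the finite dimension of the eigenspaces.
*)
theory Submission
  imports Defs
begin

section \<open>Hilbert spaces\<close>

text \<open>Formally \<open>H = H0 + B* A\<close>, so \<open>H f = l f\<close> reads
  \<open>(H0 - l) f = - B* A f\<close>; hence \<open>f = - R0(l) B* A f\<close>, and applying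
  \<open>A\<close> makes \<open>A f\<close> a fixed vector of \<open>K(l)\<close>. This explains why
  \<open>A\<close> inverts \<open>- G(l)\<close> on the eigenspace. The obstacle is that
  \<open>f\<close> need not lie in the domain of \<open>H0\<close> or of \<open>B* A\<close>:
  \<open>H\<close> is accessible only through its resolvent at regular points. So the eigenvalue
  equation is read as \<open>f = (H - z0)\<inverse> (l - z0) f\<close>, and \<open>z0\<close> is
  eliminated afterwards by resolvent identities. A second obstacle is that \<open>B*\<close> is only
  densely defined. Identities are therefore checked along sequences in its domain and passed to the
  limit through closed graphs. Since operators are graphs, the functional analysis reduces largely
  to separating a point from a closed subspace of a product Hilbert space.\<close>

lemma cinner_add_left: "cinner (x + y) z = cinner x z + cinner y z"
  by (metis cinner_commute cinner_add_right complex_cnj_add)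

lemma cinner_scaleC_left: "cinner (a *\<^sub>C x) y = cnj a * cinner x y"
  by (metis cinner_commute cinner_scaleC_right complex_cnj_mult)

lemma cinner_zero_right [simp]: "cinner x 0 = 0"
  using cinner_scaleC_right[of x 0 0] by simp

lemma cinner_zero_left [simp]: "cinner 0 x = 0"
  using cinner_scaleC_left[of 0 0 x] by simp

lemma cinner_minus_right: "cinner x (- y) = - cinner x y"
  using cinner_add_right[of x y "- y"] by (simp add: eq_neg_iff_add_eq_0 add.commute)

lemma cinner_minus_left: "cinner (- x) y = - cinner x y"
  using cinner_add_left[of x "- x" y] by (simp add: eq_neg_iff_add_eq_0 add.commute)

lemma cinner_diff_right: "cinner x (y - z) = cinner x y - cinner x z"
  using cinner_add_right[of x y "- z"] by (simp add: cinner_minus_right)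

lemma cinner_diff_left: "cinner (x - y) z = cinner x z - cinner y z"
  using cinner_add_left[of x "- y" z] by (simp add: cinner_minus_left)

lemmas cinner_simps = cinner_add_left cinner_add_right cinner_scaleC_left cinner_scaleC_right
  cinner_minus_left cinner_minus_right cinner_diff_left cinner_diff_right

lemma cinner_self: "cinner x x = complex_of_real ((norm x)\<^sup>2)"
proof -
  have "Im (cinner x x) = 0"
    using arg_cong[OF cinner_commute[of x x], of Im] by simp
  then show ?thesis
    by (simp add: complex_eq_iff norm_eq_sqrt_cinner cinner_ge_zero)
qed

lemma norm_scaleC: "norm (a *\<^sub>C x) = cmod a * norm (x::'a::complex_inner)"
proof -
  have "complex_of_real ((norm (a *\<^sub>C x))\<^sup>2) = (cnj a * a) * complex_of_real ((norm x)\<^sup>2)"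
    unfolding cinner_self[symmetric] by (simp add: cinner_simps)
  also have "\<dots> = complex_of_real ((cmod a * norm x)\<^sup>2)"
    by (simp add: power_mult_distrib complex_norm_square mult.commute del: of_real_power)
  finally have "(norm (a *\<^sub>C x))\<^sup>2 = (cmod a * norm x)\<^sup>2"
    using of_real_eq_iff by blast
  then show ?thesis by simp
qed

lemma cinner_norm_diff:
  "(norm (x - y))\<^sup>2 = (norm x)\<^sup>2 + (norm y)\<^sup>2 - 2 * Re (cinner x y)" for x y :: "'a::complex_inner"
proof -
  have "Re (cinner y x) = Re (cinner x y)"
    by (subst cinner_commute) simp
  then have "Re (cinner (x - y) (x - y)) = Re (cinner x x) + Re (cinner y y) - 2 * Re (cinner x y)"
    by (simp add: cinner_simps)
  then show ?thesis by (simp add: cinner_self)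
qed

lemma parallelogram:
  "(norm (x + y))\<^sup>2 + (norm (x - y))\<^sup>2 = 2 * (norm x)\<^sup>2 + 2 * (norm y)\<^sup>2"
  for x y :: "'a::complex_inner"
  using cinner_norm_diff[of x y] cinner_norm_diff[of x "- y"] by (simp add: cinner_minus_right)

text \<open>Pythagoras for the projection of \<open>x\<close> onto the line through
  \<open>y\<close>. Nonnegativity of the left side gives Cauchy-Schwarz; for a closest point, the
  loss term must vanish, which is orthogonality.\<close>

lemma norm_diff_component:
  assumes "y \<noteq> 0"
  shows "(norm (x - (cinner y x / (norm y)\<^sup>2) *\<^sub>C y))\<^sup>2 = (norm x)\<^sup>2 - (cmod (cinner y x))\<^sup>2 / (norm y)\<^sup>2"
proof -
  let ?c = "cinner y x / (norm y)\<^sup>2"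
  have "cinner x (?c *\<^sub>C y) = cinner y x * cnj (cinner y x) / (norm y)\<^sup>2"
    by (simp add: cinner_simps cinner_commute[of x y])
  also have "\<dots> = complex_of_real ((cmod (cinner y x))\<^sup>2 / (norm y)\<^sup>2)"
    by (simp only: complex_norm_square of_real_divide)
  finally have "Re (cinner x (?c *\<^sub>C y)) = (cmod (cinner y x))\<^sup>2 / (norm y)\<^sup>2"
    by (metis Re_complex_of_real)
  moreover have "norm (?c *\<^sub>C y) = cmod (cinner y x) / norm y"
    using assms by (simp add: norm_scaleC norm_divide norm_power norm_mult power2_eq_square)
  ultimately show ?thesis
    by (simp add: cinner_norm_diff power_divide)
qed

lemma Cauchy_Schwarz: "cmod (cinner x y) \<le> norm x * norm y"
proof (cases "x = 0")
  case False
  have "(cmod (cinner x y))\<^sup>2 / (norm x)\<^sup>2 \<le> (norm y)\<^sup>2"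
    using norm_diff_component[OF False, of y] by (metis zero_le_power2 diff_ge_0_iff_ge)
  then have "(cmod (cinner x y))\<^sup>2 \<le> (norm x * norm y)\<^sup>2"
    using False by (simp add: field_simps power_mult_distrib)
  then show ?thesis
    by (meson abs_le_square_iff norm_ge_zero mult_nonneg_nonneg power2_le_imp_le)
qed simp

lemma bounded_bilinear_cinner: "bounded_bilinear (cinner :: 'a::complex_inner \<Rightarrow> _)"
proof
  show "\<exists>K. \<forall>a b::'a. cmod (cinner a b) \<le> norm a * norm b * K"
    by (rule exI[of _ 1]) (simp add: Cauchy_Schwarz)
qed (simp_all add: cinner_simps scaleR_scaleC scaleR_conv_of_real scaleC_complex_def)

lemmas tendsto_cinner = bounded_bilinear.tendsto[OF bounded_bilinear_cinner]

lemma bounded_bilinear_scaleC: "bounded_bilinear (scaleC :: complex \<Rightarrow> 'a::complex_inner \<Rightarrow> 'a)"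
proof
  show "\<exists>K. \<forall>a (b::'a). norm (a *\<^sub>C b) \<le> norm a * norm b * K"
    by (rule exI[of _ 1]) (simp add: norm_scaleC)
qed (simp_all add: scaleC_add_left scaleC_add_right scaleR_scaleC scaleC_scaleC
    scaleR_conv_of_real scaleC_complex_def mult.commute)

lemmas tendsto_scaleC = bounded_bilinear.tendsto[OF bounded_bilinear_scaleC]

section \<open>The product Hilbert space, where graphs live\<close>

instantiation prod :: (complex_vector, complex_vector) complex_vector
begin

definition scaleC_prod :: "complex \<Rightarrow> 'a \<times> 'b \<Rightarrow> 'a \<times> 'b"
  where "scaleC_prod a p = (a *\<^sub>C fst p, a *\<^sub>C snd p)"

instance
  by standard (simp_all add: scaleC_prod_def prod_eq_iff scaleC_add_left scaleC_add_right
      scaleC_scaleC scaleC_one scaleR_scaleC)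

end

text \<open>The product norm already in place is the Hilbert sum norm, so topological closures of
  graphs are closures in a Hilbert space.\<close>

instantiation prod :: (complex_inner, complex_inner) complex_inner
begin

definition cinner_prod :: "'a \<times> 'b \<Rightarrow> 'a \<times> 'b \<Rightarrow> complex"
  where "cinner_prod p q = cinner (fst p) (fst q) + cinner (snd p) (snd q)"

instance
proof
  fix p q r :: "'a \<times> 'b" and a :: complex
  show "cinner p q = cnj (cinner q p)"
    by (simp add: cinner_prod_def flip: cinner_commute)
  show "norm p = sqrt (Re (cinner p p))"
    by (simp add: norm_prod_def cinner_prod_def cinner_self)
qed (simp_all add: cinner_prod_def scaleC_prod_def cinner_simps algebra_simps cinner_ge_zero)

end

instance prod :: (chilbert_space, chilbert_space) chilbert_space ..

abbreviation csubspace :: "'a::complex_vector set \<Rightarrow> bool"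
  where "csubspace \<equiv> complex_vector.subspace"

section \<open>Closed subspaces, orthogonality and uniform boundedness\<close>

lemma csubspace_closure:
  fixes V :: "'a::complex_inner set"
  assumes "csubspace V"
  shows "csubspace (closure V)"
proof (rule complex_vector.subspaceI)
  show "0 \<in> closure V"
    using complex_vector.subspace_0[OF assms] closure_subset by blast
next
  fix x y assume "x \<in> closure V" "y \<in> closure V"
  then obtain f g where "\<And>n. f n \<in> V" "f \<longlonglongrightarrow> x" "\<And>n. g n \<in> V" "g \<longlonglongrightarrow> y"
    by (meson closure_sequential)
  then show "x + y \<in> closure V"
    unfolding closure_sequential
    by (intro exI[of _ "\<lambda>n. f n + g n"]) (auto intro: tendsto_add complex_vector.subspace_add[OF assms])
next
  fix c x assume "x \<in> closure V"
  then obtain f where "\<And>n. f n \<in> V" "f \<longlonglongrightarrow> x"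
    by (meson closure_sequential)
  then show "c *\<^sub>C x \<in> closure V"
    unfolding closure_sequential
    by (intro exI[of _ "\<lambda>n. c *\<^sub>C f n"])
      (auto intro: tendsto_scaleC tendsto_const complex_vector.subspace_scale[OF assms])
qed

text \<open>A minimising sequence is Cauchy: the midpoint of two almost-minimisers lies in
  \<open>V\<close>, hence is no closer to \<open>x\<close> than the infimum, and the parallelogram
  law then makes their difference small.\<close>

lemma closest_point_exists:
  fixes V :: "'a::chilbert_space set"
  assumes V: "csubspace V" "closed V"
  obtains v where "v \<in> V" "\<And>w. w \<in> V \<Longrightarrow> norm (x - v) \<le> norm (x - w)"
proof -
  define D where "D = (\<lambda>w. (norm (x - w))\<^sup>2) ` V"
  define d where "d = Inf D"
  have "D \<noteq> {}" and bdd: "bdd_below D"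
    using complex_vector.subspace_0[OF V(1)] by (auto simp: D_def intro!: bdd_belowI[of _ 0])
  have d_le: "d \<le> (norm (x - w))\<^sup>2" if "w \<in> V" for w
    unfolding d_def using that bdd by (auto simp: D_def intro!: cInf_lower)
  have "\<exists>w\<in>V. (norm (x - w))\<^sup>2 < d + 1 / real (Suc n)" for n
    using cInf_lessD[OF \<open>D \<noteq> {}\<close>, of "d + 1 / real (Suc n)"] by (auto simp: D_def d_def)
  then obtain w where w: "\<And>n. w n \<in> V" "\<And>n. (norm (x - w n))\<^sup>2 < d + 1 / real (Suc n)"
    by metis
  have close: "(norm (w m - w n))\<^sup>2 \<le> 2 / real (Suc m) + 2 / real (Suc n)" for m n
  proof -
    have mid: "(1/2) *\<^sub>R (w m + w n) \<in> V"
      unfolding scaleR_scaleC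
      by (intro complex_vector.subspace_scale complex_vector.subspace_add V w)
    have "(x - w n) + (x - w m) = 2 *\<^sub>R (x - (1/2) *\<^sub>R (w m + w n))"
      by (simp add: algebra_simps scaleR_2)
    then have "(norm ((x - w n) + (x - w m)))\<^sup>2 = 4 * (norm (x - (1/2) *\<^sub>R (w m + w n)))\<^sup>2"
      by (simp add: power_mult_distrib)
    moreover have "(x - w n) - (x - w m) = w m - w n"
      by simp
    ultimately have "(norm (w m - w n))\<^sup>2
        = 2 * (norm (x - w n))\<^sup>2 + 2 * (norm (x - w m))\<^sup>2 - 4 * (norm (x - (1/2) *\<^sub>R (w m + w n)))\<^sup>2"
      using parallelogram[of "x - w n" "x - w m"] by simp
    then show ?thesis
      using d_le[OF mid] w(2)[of m] w(2)[of n] by simp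
  qed
  have "Cauchy w"
  proof (rule metric_CauchyI)
    fix e :: real assume "0 < e"
    then obtain N where N: "4 / e\<^sup>2 < real (Suc N)"
      using reals_Archimedean2[of "4 / e\<^sup>2"] by (metis less_trans of_nat_less_iff lessI)
    have "dist (w m) (w n) < e" if "m \<ge> N" "n \<ge> N" for m n
    proof -
      have "(norm (w m - w n))\<^sup>2 \<le> 2 / real (Suc m) + 2 / real (Suc n)"
        by (rule close)
      also have "\<dots> \<le> 2 / real (Suc N) + 2 / real (Suc N)"
        using that by (intro add_mono divide_left_mono) auto
      also have "\<dots> = 4 / real (Suc N)"
        by simp
      also have "\<dots> < e\<^sup>2"
        using N \<open>0 < e\<close> by (simp add: field_simps)
      finally show ?thesis
        using \<open>0 < e\<close> by (simp add: dist_norm power2_less_imp_less)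
    qed
    then show "\<exists>M. \<forall>m\<ge>M. \<forall>n\<ge>M. dist (w m) (w n) < e" by blast
  qed
  then obtain v where v: "w \<longlonglongrightarrow> v"
    by (meson Cauchy_convergent convergent_def)
  have "v \<in> V"
    using closed_sequentially[OF V(2)] w(1) v by blast
  have "(\<lambda>n. (norm (x - w n))\<^sup>2) \<longlonglongrightarrow> (norm (x - v))\<^sup>2"
    by (intro tendsto_intros v)
  moreover have "(\<lambda>n. d + 1 / real (Suc n)) \<longlonglongrightarrow> d + 0"
    by (intro tendsto_intros LIMSEQ_Suc[OF lim_const_over_n, of 1])
  ultimately have "(norm (x - v))\<^sup>2 \<le> d"
    using LIMSEQ_le[of _ "(norm (x - v))\<^sup>2" _ "d + 0"] less_imp_le[OF w(2)] by auto
  then have "norm (x - v) \<le> norm (x - u)" if "u \<in> V" for u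
    using d_le[OF that] by (meson order_trans power2_le_imp_le norm_ge_zero)
  with \<open>v \<in> V\<close> show thesis by (rule that)
qed

text \<open>The separating vector is \<open>x\<close> minus its closest point in \<open>V\<close>.
  Applied to graphs, this serves both for the density of adjoint domains and for the representation
  of bounded functionals.\<close>

lemma orthogonal_separation:
  fixes V :: "'a::chilbert_space set"
  assumes V: "csubspace V" "closed V" and x: "x \<notin> V"
  obtains u where "\<And>v. v \<in> V \<Longrightarrow> cinner u v = 0" "cinner u x \<noteq> 0"
proof -
  obtain v where v: "v \<in> V" "\<And>w. w \<in> V \<Longrightarrow> norm (x - v) \<le> norm (x - w)"
    using closest_point_exists[OF V] by blast
  have *: "cinner w (x - v) = 0" if "w \<in> V" for w
  proof (cases "w = 0")
    case False
    \<comment> \<open>Moving from \<open>v\<close> by the component of \<open>x - v\<close> along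
      \<open>w\<close> stays in \<open>V\<close> and would come strictly closer to \<open>x\<close>
      unless that component is zero.\<close>
    let ?c = "cinner w (x - v) / (norm w)\<^sup>2"
    have "v + ?c *\<^sub>C w \<in> V"
      by (intro complex_vector.subspace_add complex_vector.subspace_scale V v that)
    from v(2)[OF this] have "norm (x - v) \<le> norm (x - v - ?c *\<^sub>C w)"
      by (simp add: algebra_simps)
    then have "(norm (x - v))\<^sup>2 \<le> (norm (x - v - ?c *\<^sub>C w))\<^sup>2"
      by (simp add: power_mono)
    then have "(cmod (cinner w (x - v)))\<^sup>2 / (norm w)\<^sup>2 \<le> 0"
      unfolding norm_diff_component[OF False] by simp
    then show ?thesis
      using False by (simp add: divide_le_0_iff)
  qed simp
  show thesis
  proof (rule that[of "x - v"])
    show orth: "cinner (x - v) w = 0" if "w \<in> V" for w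
      using *[OF that] cinner_commute[of "x - v" w] by simp
    have "cinner (x - v) x = cinner (x - v) (x - v)"
      using orth[OF v(1)] by (simp add: cinner_diff_right)
    then show "cinner (x - v) x \<noteq> 0"
      using x v(1) by (auto simp: cinner_self)
  qed
qed

lemma dense_if_no_orthogonal:
  fixes V :: "'a::chilbert_space set"
  assumes "csubspace V" "\<And>x. (\<And>v. v \<in> V \<Longrightarrow> cinner x v = 0) \<Longrightarrow> x = 0"
  shows "closure V = UNIV"
proof (rule ccontr)
  assume "closure V \<noteq> UNIV"
  then obtain x where "x \<notin> closure V" by blast
  then obtain u where u: "\<And>v. v \<in> closure V \<Longrightarrow> cinner u v = 0" "cinner u x \<noteq> 0"
    using orthogonal_separation[OF csubspace_closure[OF assms(1)]] by blast
  then have "u = 0"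
    using assms(2) closure_subset by blast
  then show False
    using u(2) by simp
qed

text \<open>By the Baire category theorem there is a ball on which one constant bounds all functionals.\<close>

lemma uniform_boundedness:
  fixes S :: "'a::chilbert_space set"
  assumes "\<And>x. \<exists>C. \<forall>s\<in>S. cmod (cinner s x) \<le> C"
  obtains C where "\<And>s. s \<in> S \<Longrightarrow> norm s \<le> C"
proof -
  define E where "E n = {x. \<forall>s\<in>S. cmod (cinner s x) \<le> real n}" for n :: nat
  have E_closed: "closed (E n)" for n
  proof -
    have "E n = (\<Inter>s\<in>S. {x. cmod (cinner s x) \<le> real n})"
      by (auto simp: E_def)
    moreover have "closed {x. cmod (cinner s x) \<le> real n}" for s
      by (intro closed_Collect_le continuous_intros
          bounded_linear.continuous_on[OF bounded_bilinear.bounded_linear_right[OF bounded_bilinear_cinner]])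
    ultimately show ?thesis by auto
  qed
  have E_cover: "(\<Union>n. E n) = UNIV"
  proof -
    have "\<exists>n. x \<in> E n" for x
    proof -
      obtain C where C: "\<forall>s\<in>S. cmod (cinner s x) \<le> C" using assms by blast
      obtain n where "C \<le> real n" using real_arch_simple by blast
      then have "x \<in> E n" using C by (fastforce simp: E_def)
      then show ?thesis ..
    qed
    then show ?thesis by blast
  qed
  have "Met_TC.mcomplete TYPE('a)"
    using complete_UNIV by (simp add: mcomplete_iff_complete)
  from Met_TC.metric_Baire_category_alt[OF this, of "range E"]
  obtain n where "interior (E n) \<noteq> {}"
    using E_closed E_cover by fastforce
  then obtain x e where e: "e > 0" "ball x e \<subseteq> E n"
    by (metis equals0I mem_interior)
  \<comment> \<open>Test \<open>s\<close> on its own multiple \<open>y\<close> of norm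
    \<open>e / 2\<close>. Both \<open>x\<close> and \<open>x + y\<close> lie in the ball, so the
    functional is at most \<open>2 n\<close> at \<open>y\<close>, where it equals
    \<open>e * norm s / 2\<close>.\<close>
  have "norm s \<le> 4 * real n / e" if s: "s \<in> S" for s
  proof (cases "s = 0")
    case False
    define y where "y = (e / (2 * norm s)) *\<^sub>R s"
    have "norm y = e / 2"
      using False e(1) by (simp add: y_def)
    then have "x \<in> ball x e" "x + y \<in> ball x e"
      using e(1) by (simp_all add: dist_norm)
    then have "cmod (cinner s x) \<le> real n" "cmod (cinner s (x + y)) \<le> real n"
      using subsetD[OF e(2)] s unfolding E_def by blast+
    then have "cmod (cinner s y) \<le> 2 * real n"
      using norm_triangle_ineq4[of "cinner s (x + y)" "cinner s x"] by (simp add: cinner_simps)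
    moreover have "cinner s y = complex_of_real (e / (2 * norm s) * (norm s)\<^sup>2)"
      by (simp add: y_def scaleR_scaleC cinner_simps cinner_self)
    then have "cmod (cinner s y) = e / (2 * norm s) * (norm s)\<^sup>2"
      using e(1) by (simp only: norm_of_real) simp
    then have "cmod (cinner s y) = e * norm s / 2"
      using False by (simp add: power2_eq_square)
    ultimately show ?thesis
      using e(1) by (simp add: field_simps)
  qed (use e in simp)
  then show thesis by (rule that)
qed

section \<open>Closed and bounded operators\<close>

text \<open>Lets closures, differences and orthogonal separation act on graphs as subspaces of the
  product.\<close>

lemma linear_operator_iff: "linear_operator T \<longleftrightarrow> single_valued T \<and> csubspace T"
  unfolding linear_operator_def complex_vector.subspace_def Ball_def split_paired_All
  by (simp add: scaleC_prod_def zero_prod_def)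

lemma csubspace_Domain:
  assumes "csubspace T"
  shows "csubspace (Domain T)"
  unfolding complex_vector.subspace_def
proof (intro conjI ballI allI)
  show "0 \<in> Domain T"
    using complex_vector.subspace_0[OF assms] by (auto simp: zero_prod_def)
next
  fix x y assume "x \<in> Domain T" "y \<in> Domain T"
  then obtain u v where "(x, u) \<in> T" "(y, v) \<in> T" by blast
  from complex_vector.subspace_add[OF assms this] show "x + y \<in> Domain T" by auto
next
  fix c x assume "x \<in> Domain T"
  then obtain u where "(x, u) \<in> T" by blast
  from complex_vector.subspace_scale[OF assms this] show "c *\<^sub>C x \<in> Domain T"
    by (auto simp: scaleC_prod_def)
qed

lemma csubspace_op_adj: "csubspace (op_adj T)"
  by (auto simp: complex_vector.subspace_def op_adj_def zero_prod_def scaleC_prod_def cinner_simps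
      split: prod.splits)

lemma csubspace_op_comp:
  assumes "csubspace S" "csubspace T"
  shows "csubspace (S \<circ>\<^sub>o T)"
  unfolding complex_vector.subspace_def
proof (intro conjI ballI allI)
  show "0 \<in> S \<circ>\<^sub>o T"
    using assms[THEN complex_vector.subspace_0] by (auto simp: op_comp_def zero_prod_def)
next
  fix p q assume "p \<in> S \<circ>\<^sub>o T" "q \<in> S \<circ>\<^sub>o T"
  then obtain x y z x' y' z' where p: "p = (x, z)" "q = (x', z')"
    and "(x, y) \<in> T" "(y, z) \<in> S" "(x', y') \<in> T" "(y', z') \<in> S"
    by (auto simp: op_comp_def)
  then have "(x + x', y + y') \<in> T" "(y + y', z + z') \<in> S"
    using complex_vector.subspace_add[OF assms(2), of "(x, y)" "(x', y')"]
      complex_vector.subspace_add[OF assms(1), of "(y, z)" "(y', z')"] by auto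
  then show "p + q \<in> S \<circ>\<^sub>o T"
    by (auto simp: p op_comp_def)
next
  fix c p assume "p \<in> S \<circ>\<^sub>o T"
  then obtain x y z where p: "p = (x, z)" and "(x, y) \<in> T" "(y, z) \<in> S"
    by (auto simp: op_comp_def)
  then have "(c *\<^sub>C x, c *\<^sub>C y) \<in> T" "(c *\<^sub>C y, c *\<^sub>C z) \<in> S"
    using complex_vector.subspace_scale[OF assms(2), of "(x, y)" c]
      complex_vector.subspace_scale[OF assms(1), of "(y, z)" c] by (auto simp: scaleC_prod_def)
  then show "c *\<^sub>C p \<in> S \<circ>\<^sub>o T"
    by (auto simp: p op_comp_def scaleC_prod_def)
qed

definition op_apply :: "('a, 'b) operator \<Rightarrow> 'a \<Rightarrow> 'b"
  where "op_apply T x = (THE y. (x, y) \<in> T)"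

lemma op_apply_eq: "single_valued T \<Longrightarrow> (x, y) \<in> T \<Longrightarrow> op_apply T x = y"
  unfolding op_apply_def by (auto dest: single_valuedD)

lemma linear_operator_mem_iff:
  assumes "linear_operator T" "Domain T = UNIV"
  shows "(x, y) \<in> T \<longleftrightarrow> y = op_apply T x"
proof -
  obtain y' where "(x, y') \<in> T" using assms(2) by blast
  then show ?thesis
    using assms(1) op_apply_eq[of T x] by (auto simp: linear_operator_iff)
qed

lemma op_apply_add:
  assumes "linear_operator T" "(x, u) \<in> T" "(y, v) \<in> T"
  shows "op_apply T (x + y) = op_apply T x + op_apply T y"
  using assms unfolding linear_operator_def by (metis op_apply_eq)

lemma op_apply_scaleC:
  assumes "linear_operator T" "(x, u) \<in> T"
  shows "op_apply T (c *\<^sub>C x) = c *\<^sub>C op_apply T x"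
  using assms unfolding linear_operator_def by (metis op_apply_eq)

lemma bounded_operators_mem_iff:
  "T \<in> bounded_operators \<Longrightarrow> (x, y) \<in> T \<longleftrightarrow> y = op_apply T x"
  by (simp add: bounded_operators_def linear_operator_mem_iff)

lemma bounded_operators_tendsto:
  assumes "T \<in> bounded_operators" "(f \<longlongrightarrow> x) F"
  shows "((\<lambda>n. op_apply T (f n)) \<longlongrightarrow> op_apply T x) F"
proof -
  note mem = bounded_operators_mem_iff[OF assms(1)]
  have lin: "linear_operator T" using assms(1) by (simp add: bounded_operators_def)
  obtain M where M: "\<And>x y. (x, y) \<in> T \<Longrightarrow> norm y \<le> M * norm x"
    using assms(1) unfolding bounded_operators_def by fast
  have "bounded_linear (op_apply T)"
  proof (rule bounded_linear_intro)
    show "op_apply T (x + y) = op_apply T x + op_apply T y" for x y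
      using op_apply_add[OF lin] mem by blast
    show "op_apply T (r *\<^sub>R x) = r *\<^sub>R op_apply T x" for r x
      unfolding scaleR_scaleC using op_apply_scaleC[OF lin] mem by blast
    show "norm (op_apply T x) \<le> norm x * M" for x
      using M[of x "op_apply T x"] mem by (simp add: mult.commute)
  qed
  then show ?thesis by (rule bounded_linear.tendsto) (rule assms(2))
qed

lemma closed_operator_bounded:
  assumes "T \<in> bounded_operators"
  shows "closed_operator T"
proof -
  have "p \<in> T" if "\<And>n. f n \<in> T" "f \<longlonglongrightarrow> p" for f p
  proof -
    have "(\<lambda>n. op_apply T (fst (f n))) \<longlonglongrightarrow> op_apply T (fst p)"
      by (intro bounded_operators_tendsto assms tendsto_fst that)
    moreover have "op_apply T (fst (f n)) = snd (f n)" for n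
      using bounded_operators_mem_iff[OF assms] that(1)[of n] by (metis prod.collapse)
    moreover have "(\<lambda>n. snd (f n)) \<longlonglongrightarrow> snd p"
      by (intro tendsto_snd that)
    ultimately have "snd p = op_apply T (fst p)"
      using LIMSEQ_unique by fastforce
    then show ?thesis
      using bounded_operators_mem_iff[OF assms] by (metis prod.collapse)
  qed
  then show ?thesis
    using assms unfolding closed_operator_def closed_sequential_limits bounded_operators_def by blast
qed

text \<open>Uniform boundedness for the image of the unit ball. \<open>T\<close> is a linear
  relation, as adjoints are in general; over \<open>x = 0\<close>, weak boundedness tested with
  \<open>y\<close> itself forces \<open>y = 0\<close>.\<close>

lemma weakly_bounded_operator:
  fixes T :: "('a::complex_inner, 'b::chilbert_space) operator"
  assumes T: "csubspace T"
    and weak: "\<And>u. \<exists>C. \<forall>(x, y)\<in>T. cmod (cinner y u) \<le> C * norm x"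
  obtains M where "\<And>x y. (x, y) \<in> T \<Longrightarrow> norm y \<le> M * norm x"
proof -
  define S where "S = {y. \<exists>x. (x, y) \<in> T \<and> norm x \<le> 1}"
  have "\<exists>C. \<forall>s\<in>S. cmod (cinner s u) \<le> C" for u
  proof -
    obtain C where C: "\<And>x y. (x, y) \<in> T \<Longrightarrow> cmod (cinner y u) \<le> C * norm x"
      using weak[of u] by blast
    have "cmod (cinner y u) \<le> \<bar>C\<bar>" if y: "(x, y) \<in> T" "norm x \<le> 1" for x y
    proof -
      have "cmod (cinner y u) \<le> C * norm x" by (rule C[OF y(1)])
      also have "\<dots> \<le> \<bar>C\<bar> * 1" by (rule mult_mono) (use y in auto)
      finally show ?thesis by simp
    qed
    then show ?thesis unfolding S_def by blast
  qed
  then obtain M where M: "\<And>s. s \<in> S \<Longrightarrow> norm s \<le> M"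
    using uniform_boundedness[of S] by blast
  show thesis
  proof (rule that[of M])
    fix x y assume xy: "(x, y) \<in> T"
    show "norm y \<le> M * norm x"
    proof (cases "x = 0")
      case True
      obtain C where "cmod (cinner y y) \<le> C * norm x"
        using weak[of y] xy by blast
      then show ?thesis using True by (simp add: cinner_self)
    next
      case False
      let ?c = "complex_of_real (inverse (norm x))"
      have "(?c *\<^sub>C x, ?c *\<^sub>C y) \<in> T"
        using complex_vector.subspace_scale[OF T xy, of ?c] by (simp add: scaleC_prod_def)
      moreover have "norm (?c *\<^sub>C x) \<le> 1"
        using False by (simp add: norm_scaleC norm_inverse)
      ultimately have "norm (?c *\<^sub>C y) \<le> M"
        using M unfolding S_def by blast
      then show ?thesis
        using False unfolding norm_scaleC norm_of_real by (simp add: field_simps)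
    qed
  qed
qed

text \<open>A nonzero \<open>y\<close> orthogonal to the domain of the adjoint would put
  \<open>(0, y)\<close> into the double orthogonal complement of \<open>T\<close>, which is
  \<open>T\<close> itself as \<open>T\<close> is closed; single-valuedness forbids this.\<close>

lemma densely_defined_op_adj:
  fixes T :: "('a::chilbert_space, 'b::chilbert_space) operator"
  assumes "closed_operator T"
  shows "densely_defined (op_adj T)"
  unfolding densely_defined_def
proof (rule dense_if_no_orthogonal)
  show "csubspace (Domain (op_adj T))"
    by (intro csubspace_Domain csubspace_op_adj)
next
  fix y assume y: "\<And>v. v \<in> Domain (op_adj T) \<Longrightarrow> cinner y v = 0"
  have T: "csubspace T" "closed T" "single_valued T"
    using assms by (auto simp: closed_operator_def linear_operator_iff)
  show "y = 0"
  proof (rule ccontr)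
    assume "y \<noteq> 0"
    have "(0, 0) \<in> T"
      using complex_vector.subspace_0[OF T(1)] by (simp add: zero_prod_def)
    then have "(0, y) \<notin> T"
      using \<open>y \<noteq> 0\<close> T(3) by (auto dest: single_valuedD)
    then obtain p where p: "\<And>q. q \<in> T \<Longrightarrow> cinner p q = 0" "cinner p (0, y) \<noteq> 0"
      using orthogonal_separation[OF T(1,2)] by blast
    \<comment> \<open>The graph of the adjoint is the orthogonal complement of \<open>T\<close>,
      rotated by a quarter turn.\<close>
    have "(snd p, - fst p) \<in> op_adj T"
      using p(1) by (fastforce simp: op_adj_def cinner_prod_def cinner_minus_left eq_neg_iff_add_eq_0 add.commute)
    then have "cinner y (snd p) = 0" by (intro y) blast
    then show False
      using p(2) cinner_commute[of y "snd p"] by (simp add: cinner_prod_def)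
  qed
qed

text \<open>The bound is first obtained for the adjoint, whose domain is dense, and then transferred.\<close>

lemma closed_graph_theorem:
  fixes T :: "('a::chilbert_space, 'b::chilbert_space) operator"
  assumes T: "closed_operator T" and dom: "Domain T = UNIV"
  shows "T \<in> bounded_operators"
proof -
  have "\<exists>C. \<forall>(y, z)\<in>op_adj T. cmod (cinner z u) \<le> C * norm y" for u
  proof -
    obtain w where w: "(u, w) \<in> T" using dom by blast
    have "cmod (cinner z u) \<le> norm w * norm y" if "(y, z) \<in> op_adj T" for y z
    proof -
      have "cinner z u = cinner y w"
        using that w by (auto simp: op_adj_def)
      then show ?thesis using Cauchy_Schwarz[of y w] by (simp add: mult.commute)
    qed
    then show ?thesis by blast
  qed
  then obtain M where M: "\<And>y z. (y, z) \<in> op_adj T \<Longrightarrow> norm z \<le> M * norm y"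
    using weakly_bounded_operator[OF csubspace_op_adj, of T] by blast
  have "norm w \<le> \<bar>M\<bar> * norm x" if xw: "(x, w) \<in> T" for x w
  proof -
    \<comment> \<open>For fixed \<open>x\<close> and \<open>w\<close> the estimate holds on the
      domain of the adjoint and extends to every \<open>y\<close> by density; the choice
      \<open>y = w\<close> then bounds \<open>w\<close>.\<close>
    let ?S = "{y. cmod (cinner y w) \<le> M * norm y * norm x}"
    have "closed ?S"
      by (intro closed_Collect_le continuous_intros
          bounded_linear.continuous_on[OF bounded_bilinear.bounded_linear_left[OF bounded_bilinear_cinner]])
    moreover have "Domain (op_adj T) \<subseteq> ?S"
    proof
      fix y assume "y \<in> Domain (op_adj T)"
      then obtain z where z: "(y, z) \<in> op_adj T" by blast
      have "cinner y w = cinner z x" using z xw by (auto simp: op_adj_def)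
      then have "cmod (cinner y w) \<le> norm z * norm x"
        using Cauchy_Schwarz by metis
      also have "\<dots> \<le> M * norm y * norm x"
        by (rule mult_right_mono[OF M[OF z]]) simp
      finally show "y \<in> ?S" by simp
    qed
    ultimately have "closure (Domain (op_adj T)) \<subseteq> ?S"
      by (simp add: closure_minimal)
    then have "cmod (cinner w w) \<le> M * norm w * norm x"
      using densely_defined_op_adj[OF T] by (auto simp: densely_defined_def)
    then have "norm w * norm w \<le> norm w * (M * norm x)"
      by (simp add: cinner_self power2_eq_square norm_mult mult_ac)
    then have "norm w \<le> M * norm x" if "w \<noteq> 0"
      using that by simp
    moreover have "M * norm x \<le> \<bar>M\<bar> * norm x"
      by (simp add: mult_right_mono)
    ultimately show ?thesis
      by (cases "w = 0") auto
  qed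
  then show ?thesis
    using T dom by (auto simp: bounded_operators_def closed_operator_def)
qed

text \<open>Extension by continuity in graph form: the bound survives the closure, applied at
  \<open>(0, y - z)\<close> it gives single-valuedness, and completeness of the target fills up the
  domain.\<close>

lemma bounded_closure:
  fixes T :: "('a::complex_inner, 'b::chilbert_space) operator"
  assumes T: "csubspace T" and dense: "densely_defined T"
    and M: "\<And>x y. (x, y) \<in> T \<Longrightarrow> norm y \<le> M * norm x"
  shows "closure T \<in> bounded_operators"
proof -
  have clT: "csubspace (closure T)"
    by (rule csubspace_closure[OF T])
  have bound: "norm (snd p) \<le> M * norm (fst p)" if "p \<in> closure T" for p
  proof -
    have "closure T \<subseteq> {p. norm (snd p) \<le> M * norm (fst p)}"
      by (intro closure_minimal closed_Collect_le continuous_intros) (use M in auto)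
    with that show ?thesis by blast
  qed
  have "single_valued (closure T)"
  proof (rule single_valuedI)
    fix x y z assume "(x, y) \<in> closure T" "(x, z) \<in> closure T"
    from complex_vector.subspace_diff[OF clT this] show "y = z"
      using bound[of "(0, y - z)"] by simp
  qed
  moreover have "\<exists>y. (x, y) \<in> closure T" for x
  proof -
    have "x \<in> closure (Domain T)" using dense by (simp add: densely_defined_def)
    then obtain f where f: "\<And>n. f n \<in> Domain T" "f \<longlonglongrightarrow> x"
      unfolding closure_sequential by blast
    then obtain g where g: "\<And>n. (f n, g n) \<in> T" unfolding Domain_iff by metis
    have "Cauchy g"
    proof (rule metric_CauchyI)
      fix e :: real assume "0 < e"
      have "Cauchy f" using f(2) by (rule LIMSEQ_imp_Cauchy)
      then obtain N where N: "\<And>m n. m \<ge> N \<Longrightarrow> n \<ge> N \<Longrightarrow> dist (f m) (f n) < e / (\<bar>M\<bar> + 1)"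
        using \<open>0 < e\<close> metric_CauchyD[of f "e / (\<bar>M\<bar> + 1)"] by auto
      have "dist (g m) (g n) < e" if "m \<ge> N" "n \<ge> N" for m n
      proof -
        have "(f m - f n, g m - g n) \<in> T"
          using complex_vector.subspace_diff[OF T g[of m] g[of n]] by simp
        then have "norm (g m - g n) \<le> M * norm (f m - f n)" by (rule M)
        also have "\<dots> \<le> (\<bar>M\<bar> + 1) * norm (f m - f n)" by (rule mult_right_mono) auto
        also have "\<dots> < e"
          using N[OF that] by (simp add: dist_norm pos_less_divide_eq mult.commute)
        finally show ?thesis by (simp add: dist_norm)
      qed
      then show "\<exists>M. \<forall>m\<ge>M. \<forall>n\<ge>M. dist (g m) (g n) < e" by blast
    qed
    then obtain y where "g \<longlonglongrightarrow> y"
      by (meson Cauchy_convergent convergent_def)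
    then have "(\<lambda>n. (f n, g n)) \<longlonglongrightarrow> (x, y)"
      by (intro tendsto_Pair f)
    then show ?thesis
      unfolding closure_sequential using g by (intro exI[of _ y] exI[of _ "\<lambda>n. (f n, g n)"]) simp
  qed
  ultimately show ?thesis
    using clT bound by (fastforce simp: bounded_operators_def linear_operator_iff)
qed

text \<open>A vector orthogonal to the graph of a bounded functional represents it, up to a factor.\<close>

lemma Domain_op_adj_bounded:
  fixes T :: "('a::chilbert_space, 'b::complex_inner) operator"
  assumes T: "T \<in> bounded_operators"
  shows "Domain (op_adj T) = UNIV"
proof -
  note mem = bounded_operators_mem_iff[OF T]
  have lin: "linear_operator T" using T by (simp add: bounded_operators_def)
  have "\<exists>z. (y, z) \<in> op_adj T" for y
  proof -
    \<comment> \<open>The graph of the functional to be represented; the point \<open>(0, 1)\<close>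
      lies off it, so some vector orthogonal to \<open>P\<close> has a nonzero second
      component.\<close>
    define P where "P = {(x, cinner y (op_apply T x)) | x. True}"
    have "csubspace P"
      unfolding complex_vector.subspace_def P_def
    proof (intro conjI ballI allI; clarsimp simp: zero_prod_def scaleC_prod_def)
      show "cinner y (op_apply T 0) = 0"
        using op_apply_scaleC[OF lin, of 0 _ 0] mem by fastforce
      show "cinner y (op_apply T x) + cinner y (op_apply T x') = cinner y (op_apply T (x + x'))" for x x'
        using op_apply_add[OF lin, of x _ x'] mem by (metis cinner_add_right)
      show "c *\<^sub>C cinner y (op_apply T x) = cinner y (op_apply T (c *\<^sub>C x))" for c x
        using op_apply_scaleC[OF lin, of x _ c] mem by (metis cinner_scaleC_right scaleC_complex_def)
    qed
    moreover have "closed P"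
      unfolding closed_sequential_limits
    proof (intro allI impI, elim conjE)
      fix f p assume f: "\<forall>n. f n \<in> P" "f \<longlonglongrightarrow> p"
      have "(\<lambda>n. cinner y (op_apply T (fst (f n)))) \<longlonglongrightarrow> cinner y (op_apply T (fst p))"
        by (intro tendsto_cinner tendsto_const bounded_operators_tendsto T tendsto_fst f)
      moreover have "cinner y (op_apply T (fst (f n))) = snd (f n)" for n
        using f(1)[rule_format, of n] by (auto simp: P_def)
      moreover have "(\<lambda>n. snd (f n)) \<longlonglongrightarrow> snd p"
        by (intro tendsto_snd f)
      ultimately have "snd p = cinner y (op_apply T (fst p))"
        using LIMSEQ_unique by fastforce
      then show "p \<in> P"
        unfolding P_def by (metis (mono_tags, lifting) mem_Collect_eq prod.collapse)
    qed
    moreover have "(0, 1) \<notin> P"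
      using op_apply_scaleC[OF lin, of 0 _ 0] mem by (fastforce simp: P_def)
    ultimately obtain u where u: "\<And>q. q \<in> P \<Longrightarrow> cinner u q = 0" "cinner u (0, 1) \<noteq> 0"
      using orthogonal_separation by blast
    have "cinner (fst u) x + cnj (snd u) * cinner y (op_apply T x) = 0" for x
      using u(1)[of "(x, cinner y (op_apply T x))"]
      by (auto simp: P_def cinner_prod_def cinner_complex_def)
    moreover have "snd u \<noteq> 0"
      using u(2) by (auto simp: cinner_prod_def cinner_complex_def)
    \<comment> \<open>The first slot conjugates scalars, so \<open>- 1 / snd u\<close> accounts for
      the division by \<open>cnj (snd u)\<close>.\<close>
    ultimately have "cinner y (op_apply T x) = cinner ((- 1 / snd u) *\<^sub>C fst u) x" for x
      by (simp add: cinner_simps field_simps add_eq_0_iff)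
    then have "(y, (- 1 / snd u) *\<^sub>C fst u) \<in> op_adj T"
      by (auto simp: op_adj_def mem)
    then show ?thesis ..
  qed
  then show ?thesis by blast
qed

section \<open>Resolvents of closed operators\<close>

lemma resolvent_mem_iff: "(p, x) \<in> resolvent T z \<longleftrightarrow> (x, p + z *\<^sub>C x) \<in> T"
proof -
  have "(p, x) \<in> resolvent T z \<longleftrightarrow> (\<exists>y. p = y - z *\<^sub>C x \<and> (x, y) \<in> T)"
    by (auto simp: resolvent_def op_diff_def op_scale_def)
  then show ?thesis by (metis add_diff_cancel diff_add_cancel)
qed

lemma resolvent_set_mem_iff:
  "z \<in> resolvent_set T \<Longrightarrow> (x, p + z *\<^sub>C x) \<in> T \<longleftrightarrow> x = op_apply (resolvent T z) p"
  using bounded_operators_mem_iff[of "resolvent T z" p x]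
  by (simp add: resolvent_set_def resolvent_mem_iff)

text \<open>The graph of the resolvent is the preimage of \<open>T\<close> under a continuous linear
  map, hence closed, and the closed graph theorem adds the bound. Membership in a resolvent set thus
  becomes unique solvability.\<close>

lemma resolvent_set_iff:
  fixes T :: "('a::chilbert_space, 'a) operator"
  assumes T: "closed_operator T"
  shows "z \<in> resolvent_set T \<longleftrightarrow> (\<forall>p. \<exists>!x. (x, p + z *\<^sub>C x) \<in> T)" (is "_ \<longleftrightarrow> ?R")
proof
  assume "z \<in> resolvent_set T"
  then show ?R by (simp add: resolvent_set_mem_iff)
next
  assume R: ?R
  let ?S = "resolvent T z"
  have sub: "csubspace T" and cl: "closed T"
    using T by (auto simp: closed_operator_def linear_operator_iff)
  have "single_valued ?S"
    using R by (auto simp: single_valued_def resolvent_mem_iff)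
  moreover have "csubspace ?S"
    unfolding complex_vector.subspace_def
  proof (intro conjI ballI allI)
    show "0 \<in> ?S"
      using complex_vector.subspace_0[OF sub] by (simp add: zero_prod_def resolvent_mem_iff)
  next
    fix a b assume "a \<in> ?S" "b \<in> ?S"
    then obtain p x q y where ab: "a = (p, x)" "b = (q, y)"
      and "(x, p + z *\<^sub>C x) \<in> T" "(y, q + z *\<^sub>C y) \<in> T"
      by (metis prod.exhaust resolvent_mem_iff)
    from complex_vector.subspace_add[OF sub this(3,4)] show "a + b \<in> ?S"
      by (simp add: ab resolvent_mem_iff scaleC_add_right algebra_simps)
  next
    fix c a assume "a \<in> ?S"
    then obtain p x where a: "a = (p, x)" and "(x, p + z *\<^sub>C x) \<in> T"
      by (metis prod.exhaust resolvent_mem_iff)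
    from complex_vector.subspace_scale[OF sub this(2), of c] show "c *\<^sub>C a \<in> ?S"
      by (simp add: a resolvent_mem_iff scaleC_prod_def scaleC_add_right scaleC_scaleC mult.commute)
  qed
  moreover have "closed ?S"
  proof -
    have "?S = (\<lambda>p. (snd p, fst p + z *\<^sub>C snd p)) -` T"
      by (auto simp: resolvent_mem_iff)
    moreover have "continuous_on UNIV (\<lambda>p::'a \<times> 'a. (snd p, fst p + z *\<^sub>C snd p))"
      by (intro continuous_intros
          bounded_linear.continuous_on[OF bounded_bilinear.bounded_linear_right[OF bounded_bilinear_scaleC]])
    ultimately show ?thesis
      using cl by (simp add: closed_vimage)
  qed
  moreover have "Domain ?S = UNIV"
    using R by (auto simp: resolvent_mem_iff) (metis DomainI resolvent_mem_iff)
  ultimately show "z \<in> resolvent_set T"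
    by (simp add: resolvent_set_def closed_graph_theorem closed_operator_def linear_operator_iff)
qed

lemma op_comp_iff: "(x, z) \<in> S \<circ>\<^sub>o T \<longleftrightarrow> (\<exists>y. (x, y) \<in> T \<and> (y, z) \<in> S)"
  by (simp add: op_comp_def)

lemma bounded_op_apply:
  assumes "T \<in> bounded_operators"
  shows op_apply_bounded_add: "op_apply T (x + y) = op_apply T x + op_apply T y"
    and op_apply_bounded_scaleC: "op_apply T (c *\<^sub>C x) = c *\<^sub>C op_apply T x"
    and op_apply_bounded_minus: "op_apply T (- x) = - op_apply T x"
    and op_apply_bounded_diff: "op_apply T (x - y) = op_apply T x - op_apply T y"
proof -
  have lin: "linear_operator T"
    using assms by (simp add: bounded_operators_def)
  show add: "op_apply T (x + y) = op_apply T x + op_apply T y" for x y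
    using op_apply_add[OF lin] bounded_operators_mem_iff[OF assms] by blast
  show scale: "op_apply T (c *\<^sub>C x) = c *\<^sub>C op_apply T x" for c x
    using op_apply_scaleC[OF lin] bounded_operators_mem_iff[OF assms] by blast
  show minus: "op_apply T (- x) = - op_apply T x" for x
    using scale[of "- 1" x] by (simp add: scaleC_one)
  show "op_apply T (x - y) = op_apply T x - op_apply T y"
    using add[of x "- y"] by (simp add: minus)
qed

text \<open>The resolvent at 1 inverts \<open>T - 1\<close>, while the perturbation formula uses
  \<open>1 - T\<close>; hence the change of sign of \<open>p\<close> in the proof.\<close>

lemma resolvent_set_bounded_iff:
  fixes T :: "('a::chilbert_space, 'a) operator"
  assumes "T \<in> bounded_operators"
  shows "1 \<in> resolvent_set T \<longleftrightarrow> (\<forall>p. \<exists>!x. x - op_apply T x = p)"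
proof -
  have "1 \<in> resolvent_set T \<longleftrightarrow> (\<forall>p. \<exists>!x. p + x = op_apply T x)"
    by (simp add: resolvent_set_iff[OF closed_operator_bounded[OF assms]]
        bounded_operators_mem_iff[OF assms] scaleC_one)
  also have "\<dots> \<longleftrightarrow> (\<forall>p. \<exists>!x. - p + x = op_apply T x)"
  proof -
    have "(\<forall>p. P p) \<longleftrightarrow> (\<forall>p. P (- p))" for P :: "'a \<Rightarrow> bool"
      by (metis minus_minus)
    then show ?thesis .
  qed
  also have "\<dots> \<longleftrightarrow> (\<forall>p. \<exists>!x. x - op_apply T x = p)"
  proof -
    have "- p + x = y \<longleftrightarrow> x - y = p" for p x y :: 'a
      by (auto simp: algebra_simps)
    then show ?thesis by simp
  qed
  finally show ?thesis .
qed

section \<open>Finite-dimensional subspaces\<close>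

lemma cinner_sum_right: "cinner x (\<Sum>i\<in>I. f i) = (\<Sum>i\<in>I. cinner x (f i))"
  by (induction I rule: infinite_finite_induct) (simp_all add: cinner_add_right)

text \<open>Orthonormal fixed vectors lie in the image of the unit ball and are
  \<open>sqrt 2\<close> apart, so a ball of radius 1/2 of a finite cover contains at most one of
  them. An orthonormal family of maximal size must then span, since a nonzero remainder could be
  normalised and added.\<close>

lemma finite_cdim_fixed_compact:
  fixes T :: "('a::complex_inner, 'a) operator"
  assumes "compact_operator T"
  shows "finite_cdim {x. op_apply T x = x}" (is "finite_cdim ?V")
proof -
  have T: "T \<in> bounded_operators" and cpt: "compact (closure (T `` cball 0 1))"
    using assms by (auto simp: compact_operator_def)
  have V: "csubspace ?V"
    using bounded_op_apply(2)[OF T, of 0 0]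
    by (auto simp: complex_vector.subspace_def bounded_op_apply[OF T])
  define ortho where
    "ortho E \<longleftrightarrow> E \<subseteq> ?V \<and> (\<forall>e\<in>E. \<forall>e'\<in>E. cinner e e' = (if e = e' then 1 else 0))" for E
  obtain k where k: "finite k" "closure (T `` cball 0 1) \<subseteq> (\<Union>x\<in>k. ball x (1/2))"
    using cpt unfolding compact_eq_totally_bounded by (metis half_gt_zero_iff zero_less_one)
  have card: "finite E \<and> card E \<le> card k" if E: "ortho E" for E
  proof -
    have norm1: "norm e = 1" if "e \<in> E" for e
      using E that by (simp add: ortho_def norm_eq_sqrt_cinner)
    have "\<exists>x\<in>k. dist x e < 1/2" if "e \<in> E" for e
    proof -
      have "(e, e) \<in> T"
        using E that by (auto simp: ortho_def bounded_operators_mem_iff[OF T])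
      moreover have "e \<in> cball 0 1"
        using norm1[OF that] by simp
      ultimately have "e \<in> T `` cball 0 1"
        by (rule ImageI)
      from subsetD[OF k(2) subsetD[OF closure_subset this]] show ?thesis by auto
    qed
    then obtain c where c: "\<And>e. e \<in> E \<Longrightarrow> c e \<in> k \<and> dist (c e) e < 1/2"
      by metis
    have "inj_on c E"
    proof (rule inj_onI, rule ccontr)
      fix e e' assume e: "e \<in> E" "e' \<in> E" "c e = c e'" "e \<noteq> e'"
      have "dist e e' < 1/2 + 1/2"
        using c[OF e(1)] c[OF e(2)] e(3) dist_triangle3[of e e' "c e"] by simp
      then have "(norm (e - e'))\<^sup>2 < 1"
        by (simp add: dist_norm power_less_one_iff)
      moreover have "(norm (e - e'))\<^sup>2 = 2"
        using E e by (simp add: cinner_norm_diff norm1 ortho_def)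
      ultimately show False by simp
    qed
    then show ?thesis
      using c k(1) by (intro conjI inj_on_finite[of c E k] card_inj_on_le[of c E k]) auto
  qed
  have "ortho {}" by (simp add: ortho_def)
  then obtain E where E: "ortho E" and E_max: "\<And>E'. ortho E' \<Longrightarrow> card E' \<le> card E"
    using ex_has_greatest_nat[of ortho "{}" card "Suc (card k)"] card by (meson le_imp_less_Suc)
  have "finite E" using card[OF E] by simp
  have "v \<in> cspan E" if v: "v \<in> ?V" for v
  proof -
    define s where "s = (\<Sum>e\<in>E. cinner e v *\<^sub>C e)"
    have s: "s \<in> cspan E"
      unfolding s_def
      by (intro complex_vector.span_sum complex_vector.span_scale complex_vector.span_base)
    have "cspan E \<subseteq> ?V"
      using E by (intro complex_vector.span_minimal V) (simp add: ortho_def)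
    then have vs: "v - s \<in> ?V"
      using s v by (intro complex_vector.subspace_diff V) auto
    have orth: "cinner e (v - s) = 0" if e: "e \<in> E" for e
    proof -
      have "cinner e s = (\<Sum>e'\<in>E. if e' = e then cinner e v else 0)"
        unfolding s_def cinner_sum_right
        by (rule sum.cong) (use E e in \<open>auto simp: ortho_def cinner_simps\<close>)
      also have "\<dots> = cinner e v"
        using \<open>finite E\<close> e by simp
      finally show ?thesis by (simp add: cinner_simps)
    qed
    have "v - s = 0"
    proof (rule ccontr)
      assume nz: "v - s \<noteq> 0"
      define e where "e = complex_of_real (inverse (norm (v - s))) *\<^sub>C (v - s)"
      have "e \<in> ?V"
        unfolding e_def by (rule complex_vector.subspace_scale[OF V vs])
      moreover have e1: "cinner e e = 1"
      proof -
        have "norm e = 1"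
          unfolding e_def norm_scaleC norm_of_real using nz by simp
        then show ?thesis by (simp add: cinner_self)
      qed
      moreover have e0: "cinner e' e = 0" if "e' \<in> E" for e'
        using orth[OF that] by (simp add: e_def cinner_scaleC_right)
      moreover have "cinner e e' = 0" if "e' \<in> E" for e'
        using e0[OF that] by (subst cinner_commute) simp
      ultimately have "ortho (insert e E)"
        using E by (auto simp: ortho_def)
      moreover have "e \<notin> E" using e0 e1 by fastforce
      ultimately show False
        using E_max[of "insert e E"] \<open>finite E\<close> by simp
    qed
    then show ?thesis using s by simp
  qed
  then show ?thesis
    unfolding finite_cdim_def using \<open>finite E\<close> by blast
qed

text \<open>Injectivity is asked on \<open>W\<close> alone because \<open>- G(l)\<close> is only
  known to be injective on eigenvectors. In infinite dimension both values of \<open>cdim\<close>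
  are 0, so finiteness is transferred separately.\<close>

lemma clinear_image_subspace:
  fixes F :: "'a::complex_vector \<Rightarrow> 'b::complex_vector"
  assumes W: "csubspace W"
    and add: "\<And>x y. F (x + y) = F x + F y" and scale: "\<And>c x. F (c *\<^sub>C x) = c *\<^sub>C F x"
    and ker: "\<And>x. x \<in> W \<Longrightarrow> F x = 0 \<Longrightarrow> x = 0"
  shows cdim_image: "cdim (F ` W) = cdim W"
    and finite_cdim_image: "finite_cdim W \<Longrightarrow> finite_cdim (F ` W)"
proof -
  interpret F: Vector_Spaces.linear scaleC scaleC F
    by unfold_locales (simp_all add: add scale)
  have "F (x - y) = F x - F y" for x y
    by (rule F.diff)
  then have "inj_on F W"
    using ker complex_vector.subspace_diff[OF W] by (intro inj_onI) (metis eq_iff_diff_eq_0)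
  obtain b where b: "b \<subseteq> W" "complex_vector.independent b" "W \<subseteq> cspan b" "card b = cdim W"
    using complex_vector.basis_exists[of W] by blast
  have "cspan b \<subseteq> W"
    using b(1) W by (rule complex_vector.span_minimal)
  then have "complex_vector.independent (F ` b)"
    using \<open>inj_on F W\<close> b(2) inj_on_subset by (intro F.independent_injective_image) (auto simp: cspan_def)
  moreover have "F ` W \<subseteq> cspan (F ` b)"
    using b(3) F.span_image[of b] by (auto simp: cspan_def)
  moreover have "card (F ` b) = card b"
    using \<open>inj_on F W\<close> b(1) by (intro card_image) (rule inj_on_subset)
  ultimately show "cdim (F ` W) = cdim W"
    using b(1,4) complex_vector.basis_card_eq_dim[of "F ` b" "F ` W"] by (simp add: image_mono)
  assume "finite_cdim W"
  then obtain b where "finite b" "W \<subseteq> cspan b" by (auto simp: finite_cdim_def)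
  then show "finite_cdim (F ` W)"
    unfolding finite_cdim_def using F.span_image[of b]
    by (intro exI[of _ "F ` b"]) (auto simp: cspan_def)
qed

section \<open>The factorized perturbation\<close>

locale factorized_perturbation =
  fixes H0 :: "('h::chilbert_space, 'h) operator"
    and A B :: "('h, 'k::chilbert_space) operator"
  assumes H0: "closed_operator H0"
    and A: "closed_operator A" "Domain H0 \<subseteq> Domain A"
    and B: "Domain (op_adj H0) \<subseteq> Domain B"
    and K_bounded: "z \<in> resolvent_set H0 \<Longrightarrow> birman_schwinger H0 A B z \<in> bounded_operators"
begin

abbreviation R :: "complex \<Rightarrow> 'h \<Rightarrow> 'h"
  where "R z \<equiv> op_apply (resolvent H0 z)"

abbreviation G :: "complex \<Rightarrow> 'k \<Rightarrow> 'h"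
  where "G z \<equiv> op_apply (closure (resolvent H0 z \<circ>\<^sub>o op_adj B))"

abbreviation K :: "complex \<Rightarrow> 'k \<Rightarrow> 'k"
  where "K z \<equiv> op_apply (birman_schwinger H0 A B z)"

abbreviation AR :: "complex \<Rightarrow> 'h \<Rightarrow> 'k"
  where "AR z x \<equiv> op_apply A (R z x)"

lemma resolvent_bounded: "z \<in> resolvent_set H0 \<Longrightarrow> resolvent H0 z \<in> bounded_operators"
  by (simp add: resolvent_set_def)

lemma resolvent_iff: "z \<in> resolvent_set H0 \<Longrightarrow> (p, x) \<in> resolvent H0 z \<longleftrightarrow> x = R z p"
  by (rule bounded_operators_mem_iff[OF resolvent_bounded])

lemma R_mem: "z \<in> resolvent_set H0 \<Longrightarrow> (R z p, p + z *\<^sub>C R z p) \<in> H0"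
  by (simp add: resolvent_set_mem_iff)

lemma R_eqI: "z \<in> resolvent_set H0 \<Longrightarrow> (x, p + z *\<^sub>C x) \<in> H0 \<Longrightarrow> R z p = x"
  by (simp add: resolvent_set_mem_iff)

lemmas R_linear = bounded_op_apply[OF resolvent_bounded]

lemma A_sub: "csubspace A" and A_single: "single_valued A" and A_linear: "linear_operator A"
  using A(1) by (auto simp: closed_operator_def linear_operator_iff)

lemma A_eq: "(x, y) \<in> A \<Longrightarrow> op_apply A x = y"
  by (rule op_apply_eq[OF A_single])

lemma AR_mem: "z \<in> resolvent_set H0 \<Longrightarrow> (R z x, AR z x) \<in> A"
  using R_mem[of z x] A(2) A_eq by blast

lemma A_closed:
  assumes "\<And>n. (f n, g n) \<in> A" "f \<longlonglongrightarrow> x" "g \<longlonglongrightarrow> y"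
  shows "(x, y) \<in> A"
  using closed_sequentially[of A "\<lambda>n. (f n, g n)" "(x, y)"] assms A(1)
  by (auto simp: closed_operator_def intro: tendsto_Pair)

lemma AR_scaleC: "z \<in> resolvent_set H0 \<Longrightarrow> AR z (c *\<^sub>C x) = c *\<^sub>C AR z x"
  using op_apply_scaleC[OF A_linear AR_mem] by (simp add: R_linear)

lemma resolvent_identity:
  assumes "z \<in> resolvent_set H0" "w \<in> resolvent_set H0"
  shows "R z x - R w x = (z - w) *\<^sub>C R z (R w x)"
proof -
  have "x + w *\<^sub>C R w x = (x - (z - w) *\<^sub>C R w x) + z *\<^sub>C R w x"
    by (simp add: algebra_simps complex_vector.scale_left_diff_distrib)
  then have "R z (x - (z - w) *\<^sub>C R w x) = R w x"
    using R_mem[OF assms(2)] by (intro R_eqI assms) metis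
  then show ?thesis
    using assms(1) by (simp add: R_linear algebra_simps)
qed

text \<open>The adjoint of the resolvent maps into the domain of the adjoint of \<open>H0\<close>,
  hence into that of \<open>B\<close>. So \<open>B R0(z)*\<close> is everywhere defined, and
  \<open>R0(z) B*\<close> can be controlled by duality.\<close>

lemma B_adj_range:
  assumes z: "z \<in> resolvent_set H0"
  obtains w b where "(x, w) \<in> op_adj (resolvent H0 z)" "(w, b) \<in> B"
proof -
  obtain w where w: "(x, w) \<in> op_adj (resolvent H0 z)"
    using Domain_op_adj_bounded[OF resolvent_bounded[OF z]] by blast
  have "cinner w h = cinner (x + cnj z *\<^sub>C w) v" if "(v, h) \<in> H0" for v h
  proof -
    have "(h - z *\<^sub>C v, v) \<in> resolvent H0 z"
      using that by (simp add: resolvent_mem_iff)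
    then have "cinner x v = cinner w (h - z *\<^sub>C v)"
      using w by (auto simp: op_adj_def)
    then show ?thesis by (simp add: cinner_simps)
  qed
  then have "(w, x + cnj z *\<^sub>C w) \<in> op_adj H0"
    by (auto simp: op_adj_def)
  then show thesis using B w that by blast
qed

lemma csubspace_RB: "z \<in> resolvent_set H0 \<Longrightarrow> csubspace (resolvent H0 z \<circ>\<^sub>o op_adj B)"
  using resolvent_bounded[of z]
  by (intro csubspace_op_comp csubspace_op_adj) (auto simp: bounded_operators_def linear_operator_iff)

lemma ARB_closure:
  assumes z: "z \<in> resolvent_set H0"
  shows "(g, - K z g) \<in> closure (A \<circ>\<^sub>o resolvent H0 z \<circ>\<^sub>o op_adj B)"
proof -
  have "(g, K z g) \<in> birman_schwinger H0 A B z"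
    by (simp add: bounded_operators_mem_iff[OF K_bounded[OF z]])
  then show ?thesis
    by (auto simp: birman_schwinger_def op_scale_def scaleC_one)
qed

text \<open>The boundedness of \<open>K z\<close> includes that the domain of the adjoint of \<open>B\<close> is dense.\<close>

lemma G_bounded:
  assumes z: "z \<in> resolvent_set H0"
  shows "closure (resolvent H0 z \<circ>\<^sub>o op_adj B) \<in> bounded_operators"
proof -
  let ?T = "resolvent H0 z \<circ>\<^sub>o op_adj B"
  \<comment> \<open>For \<open>y = R0 B* v\<close>, moving both factors across gives
    \<open>cinner y x = cinner v b\<close> with \<open>b = B R0* x\<close>, so \<open>norm b\<close>
    serves as the constant.\<close>
  have "\<exists>C. \<forall>(v, y)\<in>?T. cmod (cinner y x) \<le> C * norm v" for x
  proof -
    obtain w b where w: "(x, w) \<in> op_adj (resolvent H0 z)" and b: "(w, b) \<in> B"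
      using B_adj_range[OF z] by blast
    have "cmod (cinner y x) \<le> norm b * norm v" if "(v, y) \<in> ?T" for v y
    proof -
      obtain t where t: "(v, t) \<in> op_adj B" "(t, y) \<in> resolvent H0 z"
        using \<open>(v, y) \<in> ?T\<close> by (auto simp: op_comp_def)
      have "cinner y x = cnj (cinner x y)"
        by (rule cinner_commute)
      also have "cinner x y = cinner w t"
        using w t(2) by (auto simp: op_adj_def)
      also have "cnj (cinner w t) = cinner t w"
        by (rule cinner_commute[symmetric])
      also have "\<dots> = cinner v b"
        using t(1) b by (auto simp: op_adj_def)
      finally show ?thesis
        using Cauchy_Schwarz[of v b] by (simp add: mult.commute)
    qed
    then show ?thesis by blast
  qed
  then obtain M where M: "\<And>v y. (v, y) \<in> ?T \<Longrightarrow> norm y \<le> M * norm v"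
    using weakly_bounded_operator[OF csubspace_RB[OF z]] by blast
  moreover have "densely_defined ?T"
    unfolding densely_defined_def
  proof (intro equalityI subset_UNIV subsetI)
    fix g :: 'k
    obtain f where "\<And>n. f n \<in> A \<circ>\<^sub>o ?T" "f \<longlonglongrightarrow> (g, - K z g)"
      using ARB_closure[OF z, of g] unfolding closure_sequential by blast
    moreover have "fst (f n) \<in> Domain ?T" for n
      using calculation(1)[of n] by (auto simp: op_comp_def[of A] case_prod_beta)
    moreover have "(\<lambda>n. fst (f n)) \<longlonglongrightarrow> g"
      using tendsto_fst[OF calculation(2)] by simp
    ultimately show "g \<in> closure (Domain ?T)"
      unfolding closure_sequential by (intro exI[of _ "\<lambda>n. fst (f n)"] conjI allI)
  qed
  ultimately show ?thesis
    using bounded_closure[OF csubspace_RB[OF z]] by blast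
qed

lemmas G_linear = bounded_op_apply[OF G_bounded]
lemmas K_linear = bounded_op_apply[OF K_bounded]

lemma G_iff: "z \<in> resolvent_set H0 \<Longrightarrow> (g, f) \<in> closure (resolvent H0 z \<circ>\<^sub>o op_adj B) \<longleftrightarrow> f = G z g"
  by (rule bounded_operators_mem_iff[OF G_bounded])

lemma G_eq:
  assumes "z \<in> resolvent_set H0" "(v, t) \<in> op_adj B"
  shows "G z v = R z t"
proof -
  have "(v, R z t) \<in> resolvent H0 z \<circ>\<^sub>o op_adj B"
    using assms by (auto simp: op_comp_def resolvent_iff)
  from subsetD[OF closure_subset this] show ?thesis
    by (simp add: G_iff[OF assms(1)])
qed

text \<open>One sequence in the domain of \<open>B*\<close> approximates \<open>g\<close> and the
  value of \<open>K\<close> together. Bounded operators such as \<open>G\<close> also converge along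
  it, so identities known on that domain reach every \<open>g\<close>.\<close>

lemma adj_B_approx:
  assumes z: "z \<in> resolvent_set H0"
  obtains v t where "\<And>n. (v n, t n) \<in> op_adj B" "v \<longlonglongrightarrow> g" "(\<lambda>n. AR z (t n)) \<longlonglongrightarrow> - K z g"
proof -
  obtain f where f: "\<And>n. f n \<in> A \<circ>\<^sub>o resolvent H0 z \<circ>\<^sub>o op_adj B" "f \<longlonglongrightarrow> (g, - K z g)"
    using ARB_closure[OF z, of g] unfolding closure_sequential by blast
  have "\<exists>t. (fst (f n), t) \<in> op_adj B \<and> AR z t = snd (f n)" for n
    using f(1)[of n] by (auto simp: op_comp_def resolvent_iff[OF z] A_eq case_prod_beta)
  then obtain t where t: "\<And>n. (fst (f n), t n) \<in> op_adj B" "\<And>n. AR z (t n) = snd (f n)"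
    by metis
  show thesis
    using tendsto_fst[OF f(2)] tendsto_snd[OF f(2)] by (intro that[OF t(1)]) (simp_all add: t(2))
qed

lemma AG:
  assumes z: "z \<in> resolvent_set H0"
  shows "(G z g, - K z g) \<in> A"
proof -
  obtain v t where v: "\<And>n. (v n, t n) \<in> op_adj B" "v \<longlonglongrightarrow> g" "(\<lambda>n. AR z (t n)) \<longlonglongrightarrow> - K z g"
    using adj_B_approx[OF z] by blast
  have "(\<lambda>n. R z (t n)) \<longlonglongrightarrow> G z g"
    using bounded_operators_tendsto[OF G_bounded[OF z] v(2)] by (simp add: G_eq[OF z v(1)])
  then show ?thesis
    by (rule A_closed[OF AR_mem[OF z] _ v(3)])
qed

lemma G_diff:
  assumes z: "z \<in> resolvent_set H0" and w: "w \<in> resolvent_set H0"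
  shows "G z g - G w g = (z - w) *\<^sub>C R z (G w g)"
proof -
  \<comment> \<open>\<open>B*\<close> does not depend on the spectral parameter, so a sequence found
    at \<open>z\<close> serves at \<open>w\<close> as well.\<close>
  obtain v t where v: "\<And>n. (v n, t n) \<in> op_adj B" "v \<longlonglongrightarrow> g"
    using adj_B_approx[OF z] by blast
  have "(\<lambda>n. G z (v n) - G w (v n)) \<longlonglongrightarrow> G z g - G w g"
    by (intro tendsto_diff bounded_operators_tendsto G_bounded assms v)
  moreover have "(\<lambda>n. (z - w) *\<^sub>C R z (G w (v n))) \<longlonglongrightarrow> (z - w) *\<^sub>C R z (G w g)"
    by (intro tendsto_scaleC tendsto_const bounded_operators_tendsto G_bounded resolvent_bounded assms v)
  moreover have "G z (v n) - G w (v n) = (z - w) *\<^sub>C R z (G w (v n))" for n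
    by (simp add: G_eq[OF z v(1)] G_eq[OF w v(1)] resolvent_identity[OF z w])
  ultimately show ?thesis
    using LIMSEQ_unique by fastforce
qed

text \<open>This is \<open>A\<close> applied to \<open>G_diff\<close>; the minus sign in
  \<open>A G = - K\<close> swaps \<open>z\<close> and \<open>w\<close> in the factor.\<close>

lemma K_diff:
  assumes z: "z \<in> resolvent_set H0" and w: "w \<in> resolvent_set H0"
  shows "K z g - K w g = (w - z) *\<^sub>C AR z (G w g)"
proof -
  have "(G z g - G w g, - K z g - - K w g) \<in> A"
    using complex_vector.subspace_diff[OF A_sub AG[OF z] AG[OF w], of g g] by simp
  then have "op_apply A ((z - w) *\<^sub>C R z (G w g)) = K w g - K z g"
    unfolding G_diff[OF z w] by (simp add: A_eq)
  then have "(z - w) *\<^sub>C AR z (G w g) = K w g - K z g"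
    using op_apply_scaleC[OF A_linear AR_mem[OF z]] by simp
  then show ?thesis
    using complex_vector.scale_minus_left[of "z - w" "AR z (G w g)"] by simp
qed

lemma G_inj_on_eigenvectors:
  assumes l: "l \<in> resolvent_set H0" and "K l g = g" "G l g = 0"
  shows "g = 0"
proof -
  have "(0, - g) \<in> A" using AG[OF l, of g] assms by simp
  moreover have "(0, 0) \<in> A" using A_linear by (simp add: linear_operator_def)
  ultimately show ?thesis using A_single by (auto dest: single_valuedD)
qed

section \<open>Regular points and the resolvent formula\<close>

definition regular :: "complex \<Rightarrow> bool"
  where "regular z \<longleftrightarrow> z \<in> resolvent_set H0 \<and> 1 \<in> resolvent_set (birman_schwinger H0 A B z)"

lemma regular_iff: "z \<in> resolvent_set H0 \<Longrightarrow> regular z \<longleftrightarrow> (\<forall>h. \<exists>!g. g - K z g = h)"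
  by (simp add: regular_def resolvent_set_bounded_iff[OF K_bounded])

definition J :: "complex \<Rightarrow> 'k \<Rightarrow> 'k"
  where "J z h = (THE g. g - K z g = h)"

lemma J_eq_iff: "regular z \<Longrightarrow> J z h = g \<longleftrightarrow> g - K z g = h"
proof -
  assume "regular z"
  then have ex: "\<exists>!g. g - K z g = h"
    using regular_iff[of z] unfolding regular_def by blast
  show ?thesis
  proof
    show "g - K z g = h" if "J z h = g"
      using theI'[OF ex] that by (simp add: J_def)
    show "J z h = g" if "g - K z g = h"
      unfolding J_def by (rule the1_equality[OF ex that])
  qed
qed

lemma J_right: "regular z \<Longrightarrow> J z h - K z (J z h) = h"
  using J_eq_iff[of z h "J z h"] by simp

text \<open>This composition is both the tail of the perturbed resolvent and the description of the
  eigenvector \<open>g\<close> in the theorem.\<close>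

lemma J_AR_iff:
  assumes "regular z"
  shows "(p, g) \<in> (Id -\<^sub>o birman_schwinger H0 A B z)\<inverse> \<circ>\<^sub>o A \<circ>\<^sub>o resolvent H0 z
    \<longleftrightarrow> g = J z (AR z p)"
proof -
  have z: "z \<in> resolvent_set H0" using assms by (simp add: regular_def)
  have "(h, g) \<in> (Id -\<^sub>o birman_schwinger H0 A B z)\<inverse> \<longleftrightarrow> h = g - K z g" for h g
    by (auto simp: op_diff_def bounded_operators_mem_iff[OF K_bounded[OF z]])
  then have "(h, g) \<in> (Id -\<^sub>o birman_schwinger H0 A B z)\<inverse> \<longleftrightarrow> g = J z h" for h g
    using J_eq_iff[OF assms, of h g] by auto
  moreover have "(p, y) \<in> A \<circ>\<^sub>o resolvent H0 z \<longleftrightarrow> y = AR z p" for y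
    using AR_mem[OF z] A_eq by (auto simp: op_comp_iff resolvent_iff[OF z])
  ultimately show ?thesis
    by (subst op_comp_iff) (simp del: converse_iff)
qed

lemma perturbed_resolvent_iff:
  assumes "regular z"
  shows "(p, x) \<in> perturbed_resolvent H0 A B z \<longleftrightarrow> x = R z p - G z (J z (AR z p))"
proof -
  have z: "z \<in> resolvent_set H0" using assms by (simp add: regular_def)
  have "(p, y) \<in> closure (resolvent H0 z \<circ>\<^sub>o op_adj B) \<circ>\<^sub>o (Id -\<^sub>o birman_schwinger H0 A B z)\<inverse>
        \<circ>\<^sub>o A \<circ>\<^sub>o resolvent H0 z \<longleftrightarrow> y = G z (J z (AR z p))" for y
    by (subst op_comp_iff) (simp add: J_AR_iff[OF assms] G_iff[OF z])
  then show ?thesis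
    by (auto simp: perturbed_resolvent_def op_diff_def resolvent_iff[OF z])
qed

section \<open>The perturbed operator: eigenvectors and resolvent set\<close>

context
  fixes H :: "('h, 'h) operator"
  assumes H: "closed_operator H"
    and H_resolvent: "regular z \<Longrightarrow> resolvent H z = perturbed_resolvent H0 A B z"
begin

lemma H_iff:
  "regular z \<Longrightarrow> (x, p + z *\<^sub>C x) \<in> H \<longleftrightarrow> x = R z p - G z (J z (AR z p))"
  using perturbed_resolvent_iff[of z p x] H_resolvent[of z] resolvent_mem_iff[of p x H z] by simp

lemma regular_imp_resolvent_set: "regular z \<Longrightarrow> z \<in> resolvent_set H"
  by (simp add: resolvent_set_iff[OF H] H_iff)

text \<open>The domain of \<open>H\<close> lies in that of \<open>A\<close>, with
  \<open>A (H - z)\<inverse> = J A R0\<close>: since \<open>A G = - K\<close>, the left side is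
  \<open>(1 + K J) A R0\<close>, and \<open>1 + K J = J\<close>.\<close>

lemma A_perturbed_resolvent:
  assumes "regular z"
  shows "(R z p - G z (J z (AR z p)), J z (AR z p)) \<in> A"
proof -
  let ?q = "J z (AR z p)"
  have z: "z \<in> resolvent_set H0" using assms by (simp add: regular_def)
  have "(R z p - G z ?q, AR z p - - K z ?q) \<in> A"
    using complex_vector.subspace_diff[OF A_sub AR_mem[OF z] AG[OF z], of p ?q] by simp
  moreover have "AR z p - - K z ?q = ?q"
    using J_right[OF assms, of "AR z p"] by (simp add: algebra_simps)
  ultimately show ?thesis by simp
qed

text \<open>The equation gives \<open>f = (H - z0)\<inverse> (l - z0) f\<close>, so
  \<open>A f = (l - z0) g\<close> by \<open>A_perturbed_resolvent\<close>. What remains is to trade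
  \<open>G z0\<close> for \<open>G l\<close>; the factor \<open>l - z0\<close> is cancelled only at
  the end.\<close>

lemma H_eigenvector:
  assumes z0: "regular z0" and l: "l \<in> resolvent_set H0" and "z0 \<noteq> l"
    and f: "(f, l *\<^sub>C f) \<in> H"
  defines "g \<equiv> J z0 (AR z0 f)"
  shows "(f, (l - z0) *\<^sub>C g) \<in> A" "f = - ((l - z0) *\<^sub>C G l g)" "K l g = g"
proof -
  let ?c = "l - z0"
  have z0': "z0 \<in> resolvent_set H0" using z0 by (simp add: regular_def)
  have "AR z0 (?c *\<^sub>C f) = ?c *\<^sub>C AR z0 f"
    by (rule AR_scaleC[OF z0'])
  moreover have "?c *\<^sub>C g - K z0 (?c *\<^sub>C g) = ?c *\<^sub>C AR z0 f"
    using J_right[OF z0, of "AR z0 f"]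
    by (simp add: K_linear[OF z0'] g_def flip: complex_vector.scale_right_diff_distrib)
  ultimately have J: "J z0 (AR z0 (?c *\<^sub>C f)) = ?c *\<^sub>C g"
    by (simp add: J_eq_iff[OF z0])
  have "(f, ?c *\<^sub>C f + z0 *\<^sub>C f) \<in> H"
    using f by (simp add: complex_vector.scale_left_diff_distrib)
  then have eq: "f = R z0 (?c *\<^sub>C f) - G z0 (J z0 (AR z0 (?c *\<^sub>C f)))"
    unfolding H_iff[OF z0] .
  show A_f: "(f, ?c *\<^sub>C g) \<in> A"
    using A_perturbed_resolvent[OF z0, of "?c *\<^sub>C f"] eq unfolding J by simp
  have "?c *\<^sub>C G z0 g = ?c *\<^sub>C R z0 f - f"
    using eq unfolding J by (simp add: R_linear[OF z0'] G_linear[OF z0'] algebra_simps)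
  \<comment> \<open>Under \<open>R l\<close> both resolvent identities apply: the left side becomes
    \<open>G l g - G z0 g\<close>, the right side collapses to \<open>- R z0 f\<close>.\<close>
  then have "?c *\<^sub>C R l (G z0 g) = R l (?c *\<^sub>C R z0 f - f)"
    by (simp flip: R_linear(2)[OF l])
  also have "\<dots> = - R z0 f"
    using resolvent_identity[OF l z0', of f, symmetric] by (simp add: R_linear[OF l])
  finally have "G l g - G z0 g = - R z0 f"
    using G_diff[OF l z0', of g] by simp
  then have "G l g = G z0 g - R z0 f"
    by (simp add: algebra_simps)
  then show f_eq: "f = - (?c *\<^sub>C G l g)"
    using \<open>?c *\<^sub>C G z0 g = ?c *\<^sub>C R z0 f - f\<close> by (simp add: complex_vector.scale_right_diff_distrib)
  \<comment> \<open>The first component is \<open>f\<close>, so \<open>A f\<close> is now known in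
    two ways.\<close>
  have "(G l (- (?c *\<^sub>C g)), - K l (- (?c *\<^sub>C g))) \<in> A"
    by (rule AG[OF l])
  then have "(f, ?c *\<^sub>C K l g) \<in> A"
    using f_eq by (simp add: K_linear[OF l] G_linear[OF l])
  then have "?c *\<^sub>C K l g = ?c *\<^sub>C g"
    by (rule single_valuedD[OF A_single _ A_f])
  then show "K l g = g"
    using \<open>z0 \<noteq> l\<close> by simp
qed

lemma K_eigenvector:
  assumes z0: "regular z0" and l: "l \<in> resolvent_set H0" and g: "K l g = g"
  shows "(- G l g, l *\<^sub>C (- G l g)) \<in> H"
proof -
  \<comment> \<open>For \<open>f = - G l g\<close> the eigenvalue equation demands
    \<open>(H - z0) f = (l - z0) f\<close>, which is \<open>?p\<close>. By \<open>K_diff\<close>,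
    \<open>J A R0\<close> sends \<open>?p\<close> back to \<open>g\<close>.\<close>
  let ?p = "(z0 - l) *\<^sub>C G l g"
  have z0': "z0 \<in> resolvent_set H0" using z0 by (simp add: regular_def)
  have "AR z0 ?p = (z0 - l) *\<^sub>C AR z0 (G l g)"
    by (rule AR_scaleC[OF z0'])
  also have "\<dots> = - ((l - z0) *\<^sub>C AR z0 (G l g))"
    by (simp flip: complex_vector.scale_minus_left)
  also have "\<dots> = g - K z0 g"
    by (simp add: g flip: K_diff[OF z0' l])
  finally have "J z0 (AR z0 ?p) = g"
    by (simp add: J_eq_iff[OF z0])
  moreover have "R z0 ?p = G z0 g - G l g"
    by (simp add: R_linear[OF z0'] G_diff[OF z0' l])
  ultimately have "(- G l g, ?p + z0 *\<^sub>C (- G l g)) \<in> H"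
    unfolding H_iff[OF z0] by simp
  then show ?thesis
    by (simp add: complex_vector.scale_left_diff_distrib)
qed

lemma H_eigenspace:
  assumes z0: "regular z0" and l: "l \<in> resolvent_set H0"
  shows "{f. (f, l *\<^sub>C f) \<in> H} = (\<lambda>g. - G l g) ` {g. K l g = g}"
proof (intro equalityI subsetI; clarsimp)
  fix f assume f: "(f, l *\<^sub>C f) \<in> H"
  show "f \<in> (\<lambda>g. - G l g) ` {g. K l g = g}"
  proof (cases "z0 = l")
    case True
    \<comment> \<open>With \<open>z0 = l\<close> there is no factor \<open>l - z0\<close> to divide
      by, but then \<open>H - l\<close> is injective and \<open>f\<close> must be 0.\<close>
    then have "l \<in> resolvent_set H" using regular_imp_resolvent_set z0 by blast
    moreover have "(f, 0 + l *\<^sub>C f) \<in> H" "(0, 0 + l *\<^sub>C 0) \<in> H"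
      using f H by (simp_all add: closed_operator_def linear_operator_def)
    ultimately have "f = 0"
      by (simp only: resolvent_set_mem_iff)
    moreover have "G l 0 = 0" "K l 0 = 0"
      using G_linear(2)[OF l, of 0 0] K_linear(2)[OF l, of 0 0] by simp_all
    ultimately show ?thesis by (intro image_eqI[of _ _ 0]) simp_all
  next
    case False
    \<comment> \<open>The preimage of \<open>f\<close> is \<open>A f\<close>, which equals
      \<open>(l - z0) g\<close>.\<close>
    from H_eigenvector[OF z0 l this f] show ?thesis
      by (intro image_eqI[of _ _ "(l - z0) *\<^sub>C J z0 (AR z0 f)"])
        (simp_all add: G_linear[OF l] K_linear[OF l])
  qed
next
  fix g assume "K l g = g"
  from K_eigenvector[OF z0 l this] show "(- G l g, - (l *\<^sub>C G l g)) \<in> H" by simp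
qed

text \<open>The inverse of \<open>1 - K l\<close> is formally \<open>1 - A (H - l)\<inverse> B*\<close>; expressing \<open>(H - l)\<inverse> B*\<close>
  through a regular point by the resolvent identity makes sense of it without compactness.\<close>

lemma resolvent_set_imp_regular:
  assumes z0: "regular z0" and l: "l \<in> resolvent_set H0" and lH: "l \<in> resolvent_set H"
  shows "regular l"
  unfolding regular_iff[OF l]
proof (intro allI ex_ex1I)
  fix h
  let ?c = "l - z0"
  have z0': "z0 \<in> resolvent_set H0" using z0 by (simp add: regular_def)
  \<comment> \<open>Formally \<open>(H - z0)\<inverse> B* h = G z0 u\<close>, because
    \<open>1 + J K = J\<close>; the right side makes sense for every \<open>h\<close>.\<close>
  define u where "u = J z0 h"
  obtain f where f: "(f, G z0 u + l *\<^sub>C f) \<in> H"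
    using lH unfolding resolvent_set_iff[OF H] by blast
  \<comment> \<open>By the resolvent identity for \<open>H\<close>, \<open>p\<close> stands for
    \<open>(H - l)\<inverse> B* h\<close>. Moreover \<open>p = (H - z0) f\<close>, so
    \<open>q = A f\<close>, and \<open>g = u - ?c *\<^sub>C q\<close> is exactly
    \<open>h - A p\<close>.\<close>
  define p where "p = G z0 u + ?c *\<^sub>C f"
  define q where "q = J z0 (AR z0 p)"
  define g where "g = u - ?c *\<^sub>C q"
  have "(f, p + z0 *\<^sub>C f) \<in> H"
    using f by (simp add: p_def complex_vector.scale_left_diff_distrib add.assoc)
  then have f_eq: "f = R z0 p - G z0 q"
    unfolding H_iff[OF z0] q_def .
  have "g - K z0 g = (u - K z0 u) - ?c *\<^sub>C (q - K z0 q)"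
    by (simp add: g_def K_linear[OF z0'] complex_vector.scale_right_diff_distrib)
  also have "\<dots> = h - ?c *\<^sub>C AR z0 p"
    by (simp add: u_def q_def J_right[OF z0])
  finally have 1: "g - K z0 g = h - ?c *\<^sub>C AR z0 p" .
  \<comment> \<open>The aim is \<open>p - ?c *\<^sub>C R z0 p\<close>, which is
    \<open>(H0 - l) R z0 p\<close>, so that \<open>R l\<close> returns
    \<open>R z0 p\<close>.\<close>
  have "G z0 g = p - ?c *\<^sub>C f - ?c *\<^sub>C G z0 q"
    by (simp add: g_def p_def G_linear[OF z0'])
  also have "\<dots> = p - ?c *\<^sub>C R z0 p"
    by (subst f_eq) (simp add: complex_vector.scale_right_diff_distrib)
  finally have "R l (G z0 g) = R l p - ?c *\<^sub>C R l (R z0 p)"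
    by (simp add: R_linear[OF l])
  also have "\<dots> = R z0 p"
    by (simp flip: resolvent_identity[OF l z0'])
  finally have 2: "K l g - K z0 g = - (?c *\<^sub>C AR z0 p)"
    using K_diff[OF l z0', of g] by (simp flip: complex_vector.scale_minus_left)
  have "g - K l g = (g - K z0 g) - (K l g - K z0 g)"
    by simp
  also have "\<dots> = h"
    unfolding 1 2 by simp
  finally show "\<exists>g. g - K l g = h" ..
next
  fix h g g' assume h: "g - K l g = h" "g' - K l g' = h"
  \<comment> \<open>Two solutions differ by a fixed vector of \<open>K l\<close>; its image under
    \<open>- G l\<close> would be an eigenvector of \<open>H\<close> at \<open>l\<close>, which the
    resolvent set excludes.\<close>
  have "K l (g - g') = (g - (g - K l g)) - (g' - (g' - K l g'))"
    by (simp add: K_linear[OF l])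
  also have "\<dots> = g - g'"
    unfolding h by simp
  finally have d: "K l (g - g') = g - g'" .
  have "(- G l (g - g'), 0 + l *\<^sub>C (- G l (g - g'))) \<in> H" "(0, 0 + l *\<^sub>C 0) \<in> H"
    using K_eigenvector[OF z0 l d] H by (simp_all add: closed_operator_def linear_operator_def)
  then have "- G l (g - g') = 0"
    using lH by (simp only: resolvent_set_mem_iff)
  then show "g = g'"
    using G_inj_on_eigenvectors[OF l d] by simp
qed

end

end

theorem theorem3p2:
  fixes H0 H :: "('h::chilbert_space, 'h) operator"
    and A B :: "('h, 'k::chilbert_space) operator"
    and l0 :: complex
  defines "K \<equiv> birman_schwinger H0 A B"
  assumes separable: "separable_space (euclidean :: 'h topology)"
      "separable_space (euclidean :: 'k topology)"
    and H0: "closed_operator H0" "densely_defined H0" "resolvent_set H0 \<noteq> {}"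
    and A: "closed_operator A" "densely_defined A" "Domain H0 \<subseteq> Domain A"
    and B: "closed_operator B" "densely_defined B" "Domain (op_adj H0) \<subseteq> Domain B"
    and K_bounded: "\<exists>z \<in> resolvent_set H0. K z \<in> bounded_operators"
    and K_regular: "\<exists>z0 \<in> resolvent_set H0. 1 \<in> resolvent_set (K z0)"
    and K_compact: "\<forall>z \<in> resolvent_set H0. compact_operator (K z)"
    and H: "closed_operator H" "densely_defined H"
      "\<forall>z \<in> resolvent_set H0. 1 \<in> resolvent_set (K z) \<longrightarrow>
        resolvent H z = perturbed_resolvent H0 A B z"
    and l0: "l0 \<in> resolvent_set H0"
  shows "(\<forall>f. (f, l0 *\<^sub>C f) \<in> H \<and> f \<noteq> 0 \<longrightarrow>
      (\<forall>z0 \<in> resolvent_set H0. 1 \<in> resolvent_set (K z0) \<and> z0 \<noteq> l0 \<longrightarrow>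
        (\<exists>g. g \<noteq> 0 \<and>
          (f, g) \<in> (Id -\<^sub>o K z0)\<inverse> \<circ>\<^sub>o A \<circ>\<^sub>o resolvent H0 z0 \<and>
          (f, g) \<in> inverse (l0 - z0) \<cdot>\<^sub>o A \<and>
          (g, g) \<in> K l0))) \<and>
    (\<forall>g. (g, g) \<in> K l0 \<and> g \<noteq> 0 \<longrightarrow>
      (\<exists>f. f \<noteq> 0 \<and>
        (g, f) \<in> (- 1) \<cdot>\<^sub>o closure (resolvent H0 l0 \<circ>\<^sub>o op_adj B) \<and>
        (f, l0 *\<^sub>C f) \<in> H)) \<and>
    finite_cdim (op_ker (H -\<^sub>o l0 \<cdot>\<^sub>o Id)) \<and>
    finite_cdim (op_ker (Id -\<^sub>o K l0)) \<and>
    cdim (op_ker (H -\<^sub>o l0 \<cdot>\<^sub>o Id)) = cdim (op_ker (Id -\<^sub>o K l0)) \<and>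
    (\<forall>z \<in> resolvent_set H0. z \<in> resolvent_set H \<longleftrightarrow> 1 \<in> resolvent_set (K z))"
proof -
  have K_bounded': "birman_schwinger H0 A B z \<in> bounded_operators" if "z \<in> resolvent_set H0" for z
    using K_compact that by (auto simp: compact_operator_def K_def)
  interpret P: factorized_perturbation H0 A B
    by unfold_locales (use H0 A B K_bounded' in auto)
  have K_iff: "(g, h) \<in> K z \<longleftrightarrow> h = P.K z g" if "z \<in> resolvent_set H0" for z g h
    unfolding K_def by (rule bounded_operators_mem_iff[OF K_bounded'[OF that]])
  have H_resolvent: "resolvent H z = perturbed_resolvent H0 A B z" if "P.regular z" for z
    using that H(3) by (simp add: P.regular_def K_def)
  have regularI: "P.regular z" if "z \<in> resolvent_set H0" "1 \<in> resolvent_set (K z)" for z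
    using that by (simp add: P.regular_def K_def)
  \<comment> \<open>This point may coincide with \<open>l0\<close>: the eigenspace description and
    the converse direction allow it, whereas the forward direction takes its own \<open>z0\<close>
    different from \<open>l0\<close>.\<close>
  obtain z1 where z1: "P.regular z1"
    using K_regular regularI by blast
  have ker_H: "op_ker (H -\<^sub>o l0 \<cdot>\<^sub>o Id) = {f. (f, l0 *\<^sub>C f) \<in> H}"
    by (auto simp: op_ker_def op_diff_def op_scale_def)
  have ker_K: "op_ker (Id -\<^sub>o K l0) = {g. P.K l0 g = g}" (is "_ = ?W")
    by (auto simp: op_ker_def op_diff_def K_iff[OF l0])
  have G_add: "- P.G l0 (x + y) = - P.G l0 x + - P.G l0 y"
    and G_scale: "- P.G l0 (c *\<^sub>C x) = c *\<^sub>C (- P.G l0 x)" for x y c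
    by (simp_all add: P.G_linear[OF l0])
  have W: "csubspace ?W"
    using P.K_linear(2)[OF l0, of 0 0] by (auto simp: complex_vector.subspace_def P.K_linear[OF l0])
  have G_ker: "g = 0" if "g \<in> ?W" "- P.G l0 g = 0" for g
    using P.G_inj_on_eigenvectors[OF l0, of g] that by simp
  have eigenspace: "{f. (f, l0 *\<^sub>C f) \<in> H} = (\<lambda>g. - P.G l0 g) ` ?W"
    by (rule P.H_eigenspace[OF H(1) H_resolvent z1 l0])
  have fin_K: "finite_cdim ?W"
    using finite_cdim_fixed_compact K_compact l0 unfolding K_def by blast
  have H_to_K: "\<exists>g. g \<noteq> 0 \<and> (f, g) \<in> (Id -\<^sub>o K z0)\<inverse> \<circ>\<^sub>o A \<circ>\<^sub>o resolvent H0 z0 \<and>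
      (f, g) \<in> inverse (l0 - z0) \<cdot>\<^sub>o A \<and> (g, g) \<in> K l0"
    if f: "(f, l0 *\<^sub>C f) \<in> H" "f \<noteq> 0"
      and z0: "z0 \<in> resolvent_set H0" "1 \<in> resolvent_set (K z0)" "z0 \<noteq> l0" for f z0
  proof -
    have reg: "P.regular z0" using z0 regularI by blast
    define g where "g = P.J z0 (P.AR z0 f)"
    note g = P.H_eigenvector[OF H(1) H_resolvent reg l0 z0(3) f(1), folded g_def]
    have "g \<noteq> 0"
      using g(2) f(2) P.G_linear(2)[OF l0, of 0 0] by auto
    moreover have "(f, g) \<in> (Id -\<^sub>o K z0)\<inverse> \<circ>\<^sub>o A \<circ>\<^sub>o resolvent H0 z0"
      unfolding K_def P.J_AR_iff[OF reg] g_def ..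
    moreover have "g = inverse (l0 - z0) *\<^sub>C (l0 - z0) *\<^sub>C g"
      using z0(3) by (simp add: scaleC_scaleC scaleC_one)
    then have "(f, g) \<in> inverse (l0 - z0) \<cdot>\<^sub>o A"
      using g(1) unfolding op_scale_def by blast
    moreover have "(g, g) \<in> K l0"
      by (simp add: K_iff[OF l0] g(3))
    ultimately show ?thesis by blast
  qed
  have K_to_H: "\<exists>f. f \<noteq> 0 \<and> (g, f) \<in> (- 1) \<cdot>\<^sub>o closure (resolvent H0 l0 \<circ>\<^sub>o op_adj B) \<and>
      (f, l0 *\<^sub>C f) \<in> H" if g: "(g, g) \<in> K l0" "g \<noteq> 0" for g
  proof (intro exI conjI)
    have fix_g: "P.K l0 g = g" using g(1) by (simp add: K_iff[OF l0])
    show "- P.G l0 g \<noteq> 0" using G_ker[of g] fix_g g(2) by auto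
    show "(g, - P.G l0 g) \<in> (- 1) \<cdot>\<^sub>o closure (resolvent H0 l0 \<circ>\<^sub>o op_adj B)"
      by (simp add: op_scale_def P.G_iff[OF l0] scaleC_one)
    show "(- P.G l0 g, l0 *\<^sub>C (- P.G l0 g)) \<in> H"
      by (rule P.K_eigenvector[OF H(1) H_resolvent z1 l0 fix_g])
  qed
  have dims: "cdim {f. (f, l0 *\<^sub>C f) \<in> H} = cdim ?W"
    unfolding eigenspace by (rule cdim_image[OF W G_add G_scale G_ker])
  have fin_H: "finite_cdim {f. (f, l0 *\<^sub>C f) \<in> H}"
    unfolding eigenspace using fin_K by (rule finite_cdim_image[OF W G_add G_scale G_ker, rotated -1])
  have resolvent_iff: "z \<in> resolvent_set H \<longleftrightarrow> 1 \<in> resolvent_set (K z)" if z: "z \<in> resolvent_set H0" for z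
  proof
    assume zH: "z \<in> resolvent_set H"
    have "P.regular z"
      by (rule P.resolvent_set_imp_regular[OF H(1) H_resolvent z1 z zH])
    then show "1 \<in> resolvent_set (K z)"
      by (simp add: P.regular_def K_def)
  next
    assume "1 \<in> resolvent_set (K z)"
    note reg = regularI[OF z this]
    show "z \<in> resolvent_set H"
      by (rule P.regular_imp_resolvent_set[OF H(1) H_resolvent reg])
  qed
  show ?thesis
    unfolding ker_H ker_K
    by (intro conjI allI impI ballI; (elim conjE)?)
      (rule H_to_K K_to_H fin_H fin_K dims resolvent_iff; assumption)+
qed

end
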